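(* Let $\mathcal{L}$ be a finite-dimensional, not necessarily unital, associative algebra over a field, and let $r[h]\in h(\mathcal{L}\otimes\mathcal{L})[[h]]$. Let $R[h]=\stackrel{\rightarrow\leftarrow}{\prod}(1+dr[h])\in(\mathcal{T}(\mathcal{L})\otimes\mathcal{T}(\mathcal{L}))[[h]]$ be the directed double product integral. Then $R[h]$ satisfies the quantum Yang-Baxter equation $$R^{1,2}[h]\,R^{1,3}[h]\,R^{2,3}[h]=R^{2,3}[h]\,R^{1,3}[h]\,R^{1,2}[h]$$ in $(\mathcal{T}(\mathcal{L})\otimes\mathcal{T}(\mathcal{L})\otimes\mathcal{T}(\mathcal{L}))[[h]]$ if and only if $$r^{1,2}[h]r^{1,3}[h]+r^{1,2}[h]r^{2,3}[h]+r^{1,3}[h]r^{2,3}[h]+r^{1,2}[h]r^{1,3}[h]r^{2,3}[h]$$ $$=r^{1,3}[h]r^{1,2}[h]+r^{2,3}[h]r^{1,2}[h]+r^{2,3}[h]r^{1,3}[h]+r^{2,3}[h]r^{1,3}[h]r^{1,2}[h]$$ in the associative algebra $(\mathcal{L}\otimes\mathcal{L}\otimes\mathcal{L})[[h]]$.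
   Context: Itô Hopf algebra. $\mathcal{T}(\mathcal{L})=\bigoplus_{n=0}^\infty\bigotimes^n\mathcal{L}$ (with $\bigotimes^0\mathcal{L}$ the ground field) is the space of all tensors over $\mathcal{L}$; elements of $\bigotimes^n\mathcal{L}$ are said to have rank $n$. It is equipped with the Itô (noncommutative extension of the shuffle) product, the unital associative product given by $$(\alpha\beta)_n=\sum_{A\cup B=\{1,\ldots,n\}}\alpha_{|A|}^{A}\,\beta_{|B|}^{B},$$ the sum being over ordered pairs $(A,B)$ of subsets, not necessarily disjoint, with union $\{1,\ldots,n\}$; here $\alpha_{|A|}^A$ means that the rank-$|A|$ component of $\alpha$ is placed, in order, in the copies of $\mathcal{L}$ labelled by $A$, similarly for $\beta$, and in places belonging to $A\cap B$ one multiplies in $\mathcal{L}$ (the factor from $\alpha$ on the left). The unit is $1_{\mathcal{T}(\mathcal{L})}=(1,0,0,\ldots)$. Formal power series. For a vector space $V$, $V[[h]]$ is the space of formal power series in $h$ with coefficients in $V$, and $hV[[h]]$ those with vanishing constant term. If $V$ is an algebra, $V[[h]]$ has the convolution (Cauchy) product. Tensor products of algebras have componentwise multiplication. Place notation. Superscripts indicate the tensor places occupied, a unit being inserted in the other places (for $\mathcal{L}$ itself one uses the unit of the algebra $\mathcal{L}'$ obtained by adjoining a unit to $\mathcal{L}$). For example, if $r=\sum x\otimes y$ then $r^{1,2}r^{1,3}=\sum\sum xx'\otimes y\otimes y'$ and $r^{1,2}r^{2,3}=\sum\sum x\otimes yx'\otimes y'$. Product integrals. For an associative algebra $\mathcal{A}$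 and $l[h]\in h(\mathcal{A}\otimes\mathcal{L})[[h]]$, define the decapitated product integrals in $(\mathcal{A}\otimes\mathcal{T}(\mathcal{L}))[[h]]$ $${}_{\mathcal{A}}\widehat{\stackrel{\rightarrow}{\prod}}(1+dl[h])=\sum_{n=1}^\infty l^{1,2}[h]l^{1,3}[h]\cdots l^{1,n+1}[h],\qquad {}_{\mathcal{A}}\widehat{\stackrel{\leftarrow}{\prod}}(1+dl[h])=\sum_{n=1}^\infty l^{1,n+1}[h]l^{1,n}[h]\cdots l^{1,2}[h],$$ where the $n$-th summand lies in $(\mathcal{A}\otimes\bigotimes^n\mathcal{L})[[h]]$ (place 1 is $\mathcal{A}$, where multiplication takes place, and places $2,\ldots,n+1$ are the copies of $\mathcal{L}$). Analogously, for $m[h]\in h(\mathcal{L}\otimes\mathcal{A})[[h]]$, define in $(\mathcal{T}(\mathcal{L})\otimes\mathcal{A})[[h]]$ $$\widehat{\stackrel{\rightarrow}{\prod}}_{\mathcal{A}}(1+dm[h])=\sum_{n=1}^\infty m^{1,n+1}[h]m^{2,n+1}[h]\cdots m^{n,n+1}[h],\qquad \widehat{\stackrel{\leftarrow}{\prod}}_{\mathcal{A}}(1+dm[h])=\sum_{n=1}^\infty m^{n,n+1}[h]m^{n-1,n+1}[h]\cdots m^{1,n+1}[h].$$ When $\mathcal{A}$ is unital, the (non-decapitated) product integrals, written without hats, are obtained by adding the unit element $1_{\mathcal{A}}\otimes 1_{\mathcal{T}(\mathcal{L})}$ (respectively $1_{\mathcal{T}(\mathcal{L})}\otimes1_{\mathcal{A}}$).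 Directed double product integral. For $r[h]\in h(\mathcal{L}\otimes\mathcal{L})[[h]]$, $$\stackrel{\rightarrow\leftarrow}{\prod}(1+dr[h])={}_{\mathcal{T}(\mathcal{L})}\stackrel{\rightarrow}{\prod}\Bigl(1+d\bigl(\widehat{\stackrel{\leftarrow}{\prod}}_{\mathcal{L}}(1+dr[h])\bigr)\Bigr)=\stackrel{\leftarrow}{\prod}_{\mathcal{T}(\mathcal{L})}\Bigl(1+d\bigl({}_{\mathcal{L}}\widehat{\stackrel{\rightarrow}{\prod}}(1+dr[h])\bigr)\Bigr),$$ an element of $(\mathcal{T}(\mathcal{L})\otimes\mathcal{T}(\mathcal{L}))[[h]]$; the two iterated expressions are known to be equal. *)

theory Defs
  imports Complex_Main "HOL-Library.Poly_Mapping"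
begin

(* Vector spaces are presented by generators and relations.  A finite formal linear combination
   of generators of type 'g is an element of 'g \<Rightarrow>\<^sub>0 'k; a vector is a coset of such combinations
   modulo a subspace of relations.  Tensor products and the tensor space T(L) thereby get their
   usual basis-free construction, as free vector spaces modulo the (multi)linearity relations. *)

section \<open>Formal linear combinations\<close>

definition fscale :: "'k::field \<Rightarrow> ('g \<Rightarrow>\<^sub>0 'k) \<Rightarrow> ('g \<Rightarrow>\<^sub>0 'k)" where
  "fscale c f = Poly_Mapping.map ((*) c) f"

lemma lookup_fscale: "Poly_Mapping.lookup (fscale c f) g = c * Poly_Mapping.lookup f g"
  by (simp add: fscale_def map.rep_eq when_def)

lemma vector_space_fscale: "vector_space (fscale :: 'k::field \<Rightarrow> ('g \<Rightarrow>\<^sub>0 'k) \<Rightarrow> _)"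
  by unfold_locales
    (auto intro!: poly_mapping_eqI simp: lookup_fscale lookup_add algebra_simps)

abbreviation fspan :: "('g \<Rightarrow>\<^sub>0 'k::field) set \<Rightarrow> ('g \<Rightarrow>\<^sub>0 'k) set" where
  "fspan \<equiv> module.span fscale"

abbreviation gen :: "'g \<Rightarrow> ('g \<Rightarrow>\<^sub>0 'k::field)" where
  "gen g \<equiv> Poly_Mapping.single g 1"

definition lin_ext :: "('g \<Rightarrow> ('h \<Rightarrow>\<^sub>0 'k::field)) \<Rightarrow> ('g \<Rightarrow>\<^sub>0 'k) \<Rightarrow> ('h \<Rightarrow>\<^sub>0 'k)" where
  "lin_ext \<phi> f = (\<Sum>g\<in>Poly_Mapping.keys f. fscale (Poly_Mapping.lookup f g) (\<phi> g))"

definition bilin_ext ::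
  "('a \<Rightarrow> 'b \<Rightarrow> ('h \<Rightarrow>\<^sub>0 'k::field)) \<Rightarrow> ('a \<Rightarrow>\<^sub>0 'k) \<Rightarrow> ('b \<Rightarrow>\<^sub>0 'k) \<Rightarrow> ('h \<Rightarrow>\<^sub>0 'k)" where
  "bilin_ext \<mu> f g = lin_ext (\<lambda>a. lin_ext (\<mu> a) g) f"

definition ftensor :: "('a \<Rightarrow>\<^sub>0 'k::field) \<Rightarrow> ('b \<Rightarrow>\<^sub>0 'k) \<Rightarrow> ('a \<times> 'b \<Rightarrow>\<^sub>0 'k)" where
  "ftensor = bilin_ext (\<lambda>a b. gen (a, b))"


section \<open>Presented algebras and their tensor products\<close>

record (overloaded) ('g, 'k) presented_algebra =
  gmult :: "'g \<Rightarrow> 'g \<Rightarrow> ('g \<Rightarrow>\<^sub>0 'k::field)"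
  rels :: "('g \<Rightarrow>\<^sub>0 'k) set"

definition cls :: "('g, 'k::field) presented_algebra \<Rightarrow> ('g \<Rightarrow>\<^sub>0 'k) \<Rightarrow> ('g \<Rightarrow>\<^sub>0 'k) set" where
  "cls A f = {g. g - f \<in> rels A}"

(* F(X)/N \<otimes> F(Y)/M  =  F(X \<times> Y) / (N \<otimes> F(Y) + F(X) \<otimes> M), with componentwise multiplication. *)
definition alg_tensor ::
  "('a, 'k::field) presented_algebra \<Rightarrow> ('b, 'k) presented_algebra
    \<Rightarrow> ('a \<times> 'b, 'k) presented_algebra"  (infixr \<open>\<otimes>\<close> 70) where
  "A \<otimes> B =
    \<lparr>gmult = (\<lambda>(a, b) (a', b'). ftensor (gmult A a a') (gmult B b b')),
     rels = fspan ({ftensor f (gen b) | f b. f \<in> rels A} \<union> {ftensor (gen a) f | a f. f \<in> rels B})\<rparr>"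


section \<open>Formal power series with coefficients in a presented algebra\<close>

type_synonym ('g, 'k) rseries = "nat \<Rightarrow> ('g \<Rightarrow>\<^sub>0 'k)"
type_synonym ('g, 'k) series = "nat \<Rightarrow> ('g \<Rightarrow>\<^sub>0 'k) set"

definition series :: "('g, 'k::field) presented_algebra \<Rightarrow> ('g, 'k) series set" where
  "series A = {X. \<forall>n. X n \<in> range (cls A)}"

definition hseries :: "('g, 'k::field) presented_algebra \<Rightarrow> ('g, 'k) series set" where
  "hseries A = {X \<in> series A. X 0 = cls A 0}"

definition reps :: "('g, 'k::field) series \<Rightarrow> ('g, 'k) rseries set" where
  "reps X = {F. \<forall>n. F n \<in> X n}"

(* As for quotient operations in Equiv_Relations: all the cosets united here coincide
   whenever the operation respects the relations. *)
definition lift1 ::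
  "('h, 'k::field) presented_algebra \<Rightarrow> (('g, 'k) rseries \<Rightarrow> ('h, 'k) rseries)
    \<Rightarrow> ('g, 'k) series \<Rightarrow> ('h, 'k) series" where
  "lift1 B \<Phi> X n = (\<Union>F\<in>reps X. cls B (\<Phi> F n))"

definition lift2 ::
  "('h, 'k::field) presented_algebra
    \<Rightarrow> (('a, 'k) rseries \<Rightarrow> ('b, 'k) rseries \<Rightarrow> ('h, 'k) rseries)
    \<Rightarrow> ('a, 'k) series \<Rightarrow> ('b, 'k) series \<Rightarrow> ('h, 'k) series" where
  "lift2 B \<Phi> X Y n = (\<Union>F\<in>reps X. \<Union>G\<in>reps Y. cls B (\<Phi> F G n))"

definition cauchy ::
  "('a \<Rightarrow> 'b \<Rightarrow> ('h \<Rightarrow>\<^sub>0 'k::field)) \<Rightarrow> ('a, 'k) rseries \<Rightarrow> ('b, 'k) rseries \<Rightarrow> ('h, 'k) rseries"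
  where "cauchy \<mu> F G n = (\<Sum>i\<le>n. bilin_ext \<mu> (F i) (G (n - i)))"

definition ser_mult ::
  "('g, 'k::field) series \<Rightarrow> ('g, 'k) presented_algebra \<Rightarrow> ('g, 'k) series \<Rightarrow> ('g, 'k) series"
  (\<open>(_ /\<bullet>\<^bsub>_\<^esub> _)\<close> [70, 0, 71] 70) where
  "X \<bullet>\<^bsub>A\<^esub> Y = lift2 A (cauchy (gmult A)) X Y"

definition ser_add ::
  "('g, 'k::field) series \<Rightarrow> ('g, 'k) presented_algebra \<Rightarrow> ('g, 'k) series \<Rightarrow> ('g, 'k) series"
  (\<open>(_ /\<oplus>\<^bsub>_\<^esub> _)\<close> [65, 0, 66] 65) where
  "X \<oplus>\<^bsub>A\<^esub> Y = lift2 A (\<lambda>F G n. F n + G n) X Y"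

definition ser_const ::
  "('g, 'k::field) presented_algebra \<Rightarrow> ('g \<Rightarrow>\<^sub>0 'k) \<Rightarrow> ('g, 'k) series" where
  "ser_const A f n = cls A (if n = 0 then f else 0)"

definition ser_place ::
  "('h, 'k::field) presented_algebra \<Rightarrow> ('g \<Rightarrow> 'h) \<Rightarrow> ('g, 'k) series \<Rightarrow> ('h, 'k) series" where
  "ser_place B p = lift1 B (\<lambda>F n. lin_ext (\<lambda>g. gen (p g)) (F n))"


section \<open>The algebra L, its unitization, and the Ito algebra T(L)\<close>

locale fin_dim_algebra = finite_dimensional_vector_space scale Basis
  for scale :: "'k::field \<Rightarrow> 'l::ring \<Rightarrow> 'l" and Basis :: "'l set" +
  assumes scale_mult_left: "scale c x * y = scale c (x * y)"
    and scale_mult_right: "x * scale c y = scale c (x * y)"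

(* Each e \<in> E inserts a vector of L into one slot of a generator; the relations
   say that generators are linear in these slots. *)
definition linearity_rels ::
  "('k::field \<Rightarrow> 'l::ring \<Rightarrow> 'l) \<Rightarrow> ('l \<Rightarrow> 'g) set \<Rightarrow> ('g \<Rightarrow>\<^sub>0 'k) set" where
  "linearity_rels scale E = fspan
    ({gen (e (x + y)) - gen (e x) - gen (e y) | e x y. e \<in> E} \<union>
     {gen (e (scale c x)) - fscale c (gen (e x)) | e c x. e \<in> E})"

definition alg_L :: "('k::field \<Rightarrow> 'l::ring \<Rightarrow> 'l) \<Rightarrow> ('l, 'k) presented_algebra" where
  "alg_L scale = \<lparr>gmult = (\<lambda>x y. gen (x * y)), rels = linearity_rels scale {\<lambda>x. x}\<rparr>"

(* L with a unit adjoined; the generator None is the new unit. *)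
definition alg_L1 :: "('k::field \<Rightarrow> 'l::ring \<Rightarrow> 'l) \<Rightarrow> ('l option, 'k) presented_algebra" where
  "alg_L1 scale =
    \<lparr>gmult = (\<lambda>x y. case (x, y) of
        (None, _) \<Rightarrow> gen y
      | (_, None) \<Rightarrow> gen x
      | (Some x', Some y') \<Rightarrow> gen (Some (x' * y'))),
     rels = linearity_rels scale {Some}\<rparr>"

(* The entry at place i when u and v occupy, in order, the places in A and B; places are
   numbered from 0. *)
definition ito_entry ::
  "'l::ring list \<Rightarrow> nat set \<Rightarrow> 'l list \<Rightarrow> nat set \<Rightarrow> nat \<Rightarrow> 'l" where
  "ito_entry u A v B i =
    (let x = u ! card {j \<in> A. j < i}; y = v ! card {j \<in> B. j < i}
     in if i \<in> A then (if i \<in> B then x * y else x) else y)"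

(* Components of rank above length u + length v vanish. *)
definition ito_mult :: "'l::ring list \<Rightarrow> 'l list \<Rightarrow> ('l list \<Rightarrow>\<^sub>0 'k::field)" where
  "ito_mult u v =
    (\<Sum>n\<le>length u + length v.
      \<Sum>(A, B) \<in> {(A, B). A \<union> B = {..<n} \<and> card A = length u \<and> card B = length v}.
        gen (map (ito_entry u A v B) [0..<n]))"

(* The word [x1, ..., xn] stands for the tensor x1 \<otimes> ... \<otimes> xn of rank n; the unit is []. *)
definition alg_T :: "('k::field \<Rightarrow> 'l::ring \<Rightarrow> 'l) \<Rightarrow> ('l list, 'k) presented_algebra" where
  "alg_T scale =
    \<lparr>gmult = ito_mult, rels = linearity_rels scale {\<lambda>x. u @ x # v | u v. True}\<rparr>"


section \<open>Product integrals\<close>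

(* The series of rank n + 1, that is l^{1,2} l^{1,3} ... l^{1,n+2}.  In the step the new
   factor multiplies on the right in place 1 and occupies a new last place. *)
primrec left_fwd_summand ::
  "('a, 'k::field) presented_algebra \<Rightarrow> ('a \<times> 'l, 'k) rseries \<Rightarrow> nat \<Rightarrow> ('a \<times> 'l list, 'k) rseries"
  where
    "left_fwd_summand A l 0 = (\<lambda>m. lin_ext (\<lambda>(a, x). gen (a, [x])) (l m))"
  | "left_fwd_summand A l (Suc n) =
      cauchy (\<lambda>(a, w) (a', x). ftensor (gmult A a a') (gen (w @ [x]))) (left_fwd_summand A l n) l"

(* The series of rank n + 1, that is m^{n+1,n+2} m^{n,n+2} ... m^{1,n+2}.  In the step the new
   factor multiplies on the left in the last place and occupies a new place just before it. *)
primrec right_bwd_summand ::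
  "('a, 'k::field) presented_algebra \<Rightarrow> ('l \<times> 'a, 'k) rseries \<Rightarrow> nat \<Rightarrow> ('l list \<times> 'a, 'k) rseries"
  where
    "right_bwd_summand A m 0 = (\<lambda>i. lin_ext (\<lambda>(x, a). gen ([x], a)) (m i))"
  | "right_bwd_summand A m (Suc n) =
      cauchy (\<lambda>(x, a) (w, a'). ftensor (gen (w @ [x])) (gmult A a a')) m (right_bwd_summand A m n)"

(* For l in h(A \<otimes> L)[[h]] the summand of rank n is divisible by h^n, so only the
   ranks 1, ..., i contribute to the coefficient of h^i. *)
definition left_fwd_dec_prod ::
  "('k::field \<Rightarrow> 'l::ring \<Rightarrow> 'l) \<Rightarrow> ('a, 'k) presented_algebra
    \<Rightarrow> ('a \<times> 'l, 'k) series \<Rightarrow> ('a \<times> 'l list, 'k) series" where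
  "left_fwd_dec_prod scale A =
    lift1 (A \<otimes> alg_T scale) (\<lambda>l i. \<Sum>n<i. left_fwd_summand A l n i)"

definition right_bwd_dec_prod ::
  "('k::field \<Rightarrow> 'l::ring \<Rightarrow> 'l) \<Rightarrow> ('a, 'k) presented_algebra
    \<Rightarrow> ('l \<times> 'a, 'k) series \<Rightarrow> ('l list \<times> 'a, 'k) series" where
  "right_bwd_dec_prod scale A =
    lift1 (alg_T scale \<otimes> A) (\<lambda>m i. \<Sum>n<i. right_bwd_summand A m n i)"

(* The product integral without hat, for A with unit (the class of) one. *)
definition left_fwd_prod ::
  "('k::field \<Rightarrow> 'l::ring \<Rightarrow> 'l) \<Rightarrow> ('a, 'k) presented_algebra \<Rightarrow> ('a \<Rightarrow>\<^sub>0 'k)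
    \<Rightarrow> ('a \<times> 'l, 'k) series \<Rightarrow> ('a \<times> 'l list, 'k) series" where
  "left_fwd_prod scale A one l =
    ser_const (A \<otimes> alg_T scale) (ftensor one (gen []))
      \<oplus>\<^bsub>A \<otimes> alg_T scale\<^esub> left_fwd_dec_prod scale A l"

definition directed_double_prod ::
  "('k::field \<Rightarrow> 'l::ring \<Rightarrow> 'l) \<Rightarrow> ('l \<times> 'l, 'k) series \<Rightarrow> ('l list \<times> 'l list, 'k) series" where
  "directed_double_prod scale r =
    left_fwd_prod scale (alg_T scale) (gen []) (right_bwd_dec_prod scale (alg_L scale) r)"

end

(* Placing the letters of a word of T(L) at increasing positions, in all possible ways, in N tensor
   copies of the unitization L1 of L turns the Ito product into componentwise multiplication, and
   for N = 0, 1, 2, ... these homomorphisms are jointly injective: the part of rank N is read off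
   from the tensors in which all N copies are occupied by elements of L.  The image of R in M copies
   for the first tensor factor and N for the second is the finite ordered double product of the
   elements 1 + r^{i,j}, and the condition on r is the Yang-Baxter equation for 1 + r, the common
   terms 1 + r^{1,2} + r^{1,3} + r^{2,3} having been cancelled.  The case of one copy each therefore
   recovers the condition on r, and conversely the Yang-Baxter equation for 1 + r passes to the
   double products by moving one factor at a time (fusion).  Products of copies of L1 are realized
   inside the monoid algebra of families of letters and units indexed by places (p, j), modulo
   linearity in each letter; p is the tensor factor and j the copy. *)

theory Submission
  imports Defs "HOL-Library.Function_Algebras" "HOL-Computational_Algebra.Formal_Power_Series"
begin

section \<open>Linear extension of maps on generators\<close>

text \<open>The Ito product is the product rule for iterated sums. \<open>word_image p N\<close> is
  an iterated sum over N steps, and two sums over increasing indices are multiplied by comparing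
  their last indices; the case of equal indices creates the products in L. In the same way a product
  integral without its unit becomes the sum of all ordered monomials in N increments, and adding 1
  turns it into the ordered product of the factors 1 + increment. The obstacle is that all algebras
  are quotients: injectivity means detecting relations, and it has to survive tensor products. It is
  therefore carried by explicit left inverses (\<open>extractor\<close>), which look at disjoint
  places and so can be tensored. Equality of series of cosets then amounts to a congruence
  \<open>\<approx>\<close> of ordinary power series over the place algebra, and the same calculus
  shows that the lifted operations are well defined. Fusion uses the Yang-Baxter equation at many
  triples of places. The condition on r mentions no places, so translating it into places and back
  moves the equation from one triple to any other.\<close>

interpretation fs: vector_space "fscale :: 'k::field \<Rightarrow> ('g \<Rightarrow>\<^sub>0 'k) \<Rightarrow> 'g \<Rightarrow>\<^sub>0 'k"
  by (rule vector_space_fscale)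

lemma keys_fscale_subset: "Poly_Mapping.keys (fscale c f) \<subseteq> Poly_Mapping.keys f"
  by (auto simp: in_keys_iff lookup_fscale)

lemma fscale_single: "fscale c (Poly_Mapping.single g d) = Poly_Mapping.single g (c * d)"
  by (rule poly_mapping_eqI) (simp add: lookup_fscale lookup_single when_def)

lemma lin_ext_superset:
  assumes "finite S" "Poly_Mapping.keys f \<subseteq> S"
  shows "lin_ext \<phi> f = (\<Sum>g\<in>S. fscale (Poly_Mapping.lookup f g) (\<phi> g))"
  unfolding lin_ext_def
  by (rule sum.mono_neutral_left) (use assms in \<open>auto simp: in_keys_iff\<close>)

lemma lin_ext_cong:
  "(\<And>g. g \<in> Poly_Mapping.keys f \<Longrightarrow> \<phi> g = \<psi> g) \<Longrightarrow> lin_ext \<phi> f = lin_ext \<psi> f"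
  by (simp add: lin_ext_def)

lemma lin_ext_0 [simp]: "lin_ext \<phi> 0 = 0"
  by (simp add: lin_ext_def)

lemma lin_ext_single: "lin_ext \<phi> (Poly_Mapping.single g c) = fscale c (\<phi> g)"
  by (subst lin_ext_superset[of "{g}"]) auto

lemma lin_ext_gen [simp]: "lin_ext \<phi> (gen g) = \<phi> g"
  by (simp add: lin_ext_single)

lemma lin_ext_add: "lin_ext \<phi> (f + g) = lin_ext \<phi> f + lin_ext \<phi> g"
proof -
  let ?S = "Poly_Mapping.keys f \<union> Poly_Mapping.keys g"
  have "Poly_Mapping.keys (f + g) \<subseteq> ?S" by (rule keys_add)
  then show ?thesis
    by (simp add: lin_ext_superset[of ?S] lookup_add fs.scale_left_distrib sum.distrib)
qed

lemma lin_ext_fscale: "lin_ext \<phi> (fscale c f) = fscale c (lin_ext \<phi> f)"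
  using keys_fscale_subset[of c f]
  by (simp add: lin_ext_superset[of "Poly_Mapping.keys f"] lookup_fscale fs.scale_sum_right)

lemma lin_ext_diff: "lin_ext \<phi> (f - g) = lin_ext \<phi> f - lin_ext \<phi> g"
  by (metis add_diff_cancel_right' diff_add_cancel lin_ext_add)

lemma lin_ext_sum: "lin_ext \<phi> (\<Sum>i\<in>S. F i) = (\<Sum>i\<in>S. lin_ext \<phi> (F i))"
  by (induction S rule: infinite_finite_induct) (simp_all add: lin_ext_add)

lemma lin_ext_fun_add: "lin_ext (\<lambda>g. \<phi> g + \<psi> g) f = lin_ext \<phi> f + lin_ext \<psi> f"
  by (simp add: lin_ext_def fs.scale_right_distrib sum.distrib)

lemma lin_ext_fun_0 [simp]: "lin_ext (\<lambda>g. 0) f = 0"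
  by (simp add: lin_ext_def)

lemma lin_ext_fun_fscale: "lin_ext (\<lambda>g. fscale c (\<psi> g)) f = fscale c (lin_ext \<psi> f)"
  by (simp add: lin_ext_def fs.scale_sum_right mult.commute)

lemma lin_ext_fun_diff: "lin_ext (\<lambda>g. \<phi> g - \<psi> g) f = lin_ext \<phi> f - lin_ext \<psi> f"
  by (simp add: lin_ext_def fs.scale_right_diff_distrib sum_subtractf)

lemma lin_ext_lin_ext: "lin_ext \<psi> (lin_ext \<phi> f) = lin_ext (\<lambda>g. lin_ext \<psi> (\<phi> g)) f"
  unfolding lin_ext_def[of \<phi>] lin_ext_def[of "\<lambda>g. lin_ext \<psi> (\<phi> g)"]
  by (simp add: lin_ext_sum lin_ext_fscale)

lemma lin_ext_swap:
  "lin_ext (\<lambda>a. lin_ext (\<lambda>b. \<phi> a b) g) f = lin_ext (\<lambda>b. lin_ext (\<lambda>a. \<phi> a b) f) g"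
  unfolding lin_ext_def
  by (simp add: fs.scale_sum_right sum.swap[of _ "Poly_Mapping.keys g"] mult.commute)

lemma lin_ext_id: "lin_ext gen f = f"
proof (rule poly_mapping_eqI)
  fix g
  have "Poly_Mapping.lookup (lin_ext gen f) g =
    (\<Sum>h\<in>Poly_Mapping.keys f. if h = g then Poly_Mapping.lookup f h else 0)"
    unfolding lin_ext_def lookup_sum
    by (rule sum.cong) (auto simp: lookup_fscale lookup_single when_def)
  then show "Poly_Mapping.lookup (lin_ext gen f) g = Poly_Mapping.lookup f g"
    by (simp add: in_keys_iff)
qed

lemma lin_ext_in_subspace:
  assumes "fs.subspace V" "\<And>g. g \<in> Poly_Mapping.keys f \<Longrightarrow> \<phi> g \<in> V"
  shows "lin_ext \<phi> f \<in> V"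
  unfolding lin_ext_def
  by (rule fs.subspace_sum[OF assms(1)]) (auto intro: assms fs.subspace_scale)

lemma subspace_lin_ext_vimage:
  assumes "fs.subspace V"
  shows "fs.subspace {f. lin_ext \<phi> f \<in> V}"
  using assms by (auto simp: fs.subspace_def lin_ext_add lin_ext_fscale)

lemma lin_ext_span_subspace:
  assumes "fs.subspace V" "\<And>f. f \<in> S \<Longrightarrow> lin_ext \<phi> f \<in> V" "f \<in> fspan S"
  shows "lin_ext \<phi> f \<in> V"
proof -
  have "fspan S \<subseteq> {f. lin_ext \<phi> f \<in> V}"
    by (rule fs.span_minimal) (use assms subspace_lin_ext_vimage in auto)
  with assms(3) show ?thesis by auto
qed

section \<open>Linear extension and multiplication in a monoid algebra\<close>

lemma fscale_mult_left:
  "fscale c f * g = fscale c (f * (g :: 'm::monoid_add \<Rightarrow>\<^sub>0 'k::field))"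
  by (simp add: fscale_def mult_map_scale_conv_mult mult.assoc)

text \<open>Scalars are multiples of the unit monomial 0. They are central even though the monoid is
  not commutative, because this monomial is neutral on both sides and the field is
  commutative.\<close>

lemma fscale_eq_mult_right:
  "fscale c f = f * (Poly_Mapping.single 0 c :: 'm::monoid_add \<Rightarrow>\<^sub>0 'k::field)"
proof -
  have "lin_ext gen f * Poly_Mapping.single 0 c = fscale c (lin_ext gen f)"
    by (simp add: lin_ext_def sum_distrib_right fscale_mult_left mult_single fs.scale_sum_right
        fscale_single mult.commute)
  then show ?thesis by (simp add: lin_ext_id)
qed

lemma fscale_mult_right:
  "f * fscale c g = fscale c (f * (g :: 'm::monoid_add \<Rightarrow>\<^sub>0 'k::field))"
  by (simp add: fscale_eq_mult_right mult.assoc)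

lemma lin_ext_times_right:
  "lin_ext \<phi> f * (y :: 'm::monoid_add \<Rightarrow>\<^sub>0 'k::field) = lin_ext (\<lambda>a. \<phi> a * y) f"
  by (simp add: lin_ext_def sum_distrib_right fscale_mult_left)

lemma lin_ext_times_left:
  "(y :: 'm::monoid_add \<Rightarrow>\<^sub>0 'k::field) * lin_ext \<phi> f = lin_ext (\<lambda>a. y * \<phi> a) f"
  by (simp add: lin_ext_def sum_distrib_left fscale_mult_right)

lemma lin_ext_mult:
  "lin_ext \<phi> f * (lin_ext \<psi> g :: 'm::monoid_add \<Rightarrow>\<^sub>0 'k::field) =
    lin_ext (\<lambda>a. lin_ext (\<lambda>b. \<phi> a * \<psi> b) g) f"
  unfolding lin_ext_times_right by (simp only: lin_ext_times_left)

lemma lin_ext_bilin_ext: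
  "lin_ext \<chi> (bilin_ext \<mu> f g) = lin_ext (\<lambda>a. lin_ext (\<lambda>b. lin_ext \<chi> (\<mu> a b)) g) f"
  by (simp add: bilin_ext_def lin_ext_lin_ext)

lemma lin_ext_bilin_ext_mult:
  fixes \<chi> :: "'h \<Rightarrow> ('m::monoid_add \<Rightarrow>\<^sub>0 'k::field)"
  assumes "\<And>a b. lin_ext \<chi> (\<mu> a b) = \<phi> a * \<psi> b"
  shows "lin_ext \<chi> (bilin_ext \<mu> f g) = lin_ext \<phi> f * lin_ext \<psi> g"
  by (simp add: lin_ext_bilin_ext lin_ext_mult assms)

section \<open>Tensors of formal linear combinations\<close>

lemma ftensor_gen_left: "ftensor (gen a) g = lin_ext (\<lambda>b. gen (a, b)) g"
  by (simp add: ftensor_def bilin_ext_def)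

lemma ftensor_gen_right: "ftensor f (gen b) = lin_ext (\<lambda>a. gen (a, b)) f"
  by (simp add: ftensor_def bilin_ext_def)

lemma ftensor_gen [simp]: "ftensor (gen a) (gen b) = gen (a, b)"
  by (simp add: ftensor_gen_left)

lemma ftensor_lin_ext:
  "ftensor (lin_ext \<phi> f) (lin_ext \<psi> g) = lin_ext (\<lambda>a. lin_ext (\<lambda>b. ftensor (\<phi> a) (\<psi> b)) g) f"
proof -
  have "ftensor (lin_ext \<phi> f) (lin_ext \<psi> g) =
    lin_ext (\<lambda>a. lin_ext (\<lambda>a'. lin_ext (\<lambda>b. lin_ext (\<lambda>b'. gen (a', b')) (\<psi> b)) g) (\<phi> a)) f"
    by (simp add: ftensor_def bilin_ext_def lin_ext_lin_ext)
  also have "\<dots> =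
    lin_ext (\<lambda>a. lin_ext (\<lambda>b. lin_ext (\<lambda>a'. lin_ext (\<lambda>b'. gen (a', b')) (\<psi> b)) (\<phi> a)) g) f"
    by (subst lin_ext_swap) (rule refl)
  finally show ?thesis by (simp add: ftensor_def bilin_ext_def)
qed

lemma ftensor_diff_left: "ftensor (f - f') g = ftensor f g - ftensor f' g"
  by (simp add: ftensor_def bilin_ext_def lin_ext_diff)

lemma ftensor_diff_right: "ftensor f (g - g') = ftensor f g - ftensor f g'"
  by (simp add: ftensor_def bilin_ext_def lin_ext_diff lin_ext_fun_diff)

lemma ftensor_fscale_left: "ftensor (fscale c f) g = fscale c (ftensor f g)"
  by (simp add: ftensor_def bilin_ext_def lin_ext_fscale)

lemma ftensor_fscale_right: "ftensor f (fscale c g) = fscale c (ftensor f g)"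
  by (simp add: ftensor_def bilin_ext_def lin_ext_fscale lin_ext_fun_fscale)

lemma ftensor_0_left [simp]: "ftensor 0 g = 0"
  by (simp add: ftensor_def bilin_ext_def)

lemma ftensor_0_right [simp]: "ftensor f 0 = 0"
  by (simp add: ftensor_def bilin_ext_def)

text \<open>The spanning relations of \<open>A \<otimes> B\<close> have a single generator in the
  second factor; expanding \<open>g\<close> in generators removes this restriction.\<close>

lemma ftensor_rels_left:
  assumes "f \<in> rels A"
  shows "ftensor f g \<in> rels (A \<otimes> B)"
proof -
  have "ftensor f g = lin_ext (\<lambda>b. ftensor f (gen b)) g"
    using ftensor_lin_ext[of gen f gen g]
    by (simp add: lin_ext_id ftensor_gen_right lin_ext_swap[of _ f])
  also have "\<dots> \<in> rels (A \<otimes> B)"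
    unfolding alg_tensor_def presented_algebra.select_convs
    by (rule lin_ext_in_subspace[OF fs.subspace_span], rule fs.span_base) (use assms in blast)
  finally show ?thesis .
qed

lemma ftensor_rels_right:
  assumes "g \<in> rels B"
  shows "ftensor f g \<in> rels (A \<otimes> B)"
proof -
  have "ftensor f g = lin_ext (\<lambda>a. ftensor (gen a) g) f"
    using ftensor_lin_ext[of gen f gen g] by (simp add: lin_ext_id ftensor_gen_left)
  also have "\<dots> \<in> rels (A \<otimes> B)"
    unfolding alg_tensor_def presented_algebra.select_convs
    by (rule lin_ext_in_subspace[OF fs.subspace_span], rule fs.span_base) (use assms in blast)
  finally show ?thesis .
qed

lemma lin_ext_ftensor_mult:
  fixes \<alpha> :: "'a \<Rightarrow> ('m::monoid_add \<Rightarrow>\<^sub>0 'k::field)"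
  shows "lin_ext (\<lambda>(a, b). \<alpha> a * \<beta> b) (ftensor f g) = lin_ext \<alpha> f * lin_ext \<beta> g"
  unfolding ftensor_def by (rule lin_ext_bilin_ext_mult) simp


section \<open>The Ito product on words\<close>

definition ito_pairs :: "nat \<Rightarrow> nat \<Rightarrow> nat \<Rightarrow> (nat set \<times> nat set) set" where
  "ito_pairs p q n = {(A, B). A \<union> B = {..<n} \<and> card A = p \<and> card B = q}"

definition ito_part :: "'l::ring list \<Rightarrow> 'l list \<Rightarrow> nat \<Rightarrow> ('l list \<Rightarrow>\<^sub>0 'k::field)" where
  "ito_part u v n = (\<Sum>(A, B)\<in>ito_pairs (length u) (length v) n.
     gen (map (ito_entry u A v B) [0..<n]))"

lemma finite_ito_pairs: "finite (ito_pairs p q n)"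
  by (rule finite_subset[of _ "Pow {..<n} \<times> Pow {..<n}"]) (auto simp: ito_pairs_def)

lemma ito_pairs_large: "p + q < n \<Longrightarrow> ito_pairs p q n = {}"
proof (rule ccontr)
  assume "p + q < n" "ito_pairs p q n \<noteq> {}"
  then obtain A B where AB: "A \<union> B = {..<n}" "card A = p" "card B = q"
    by (auto simp: ito_pairs_def)
  have "n = card (A \<union> B)" using AB by simp
  also have "\<dots> \<le> p + q" using card_Un_le[of A B] AB by simp
  finally show False using \<open>p + q < n\<close> by simp
qed

text \<open>Ranks above the total length contribute nothing. This freedom of \<open>N\<close> lets
  the products of words of different lengths in \<open>ito_mult_snoc\<close> be summed over one
  range.\<close>

lemma ito_mult_eq_part:
  assumes "length u + length v \<le> N"
  shows "ito_mult u v = (\<Sum>n\<le>N. ito_part u v n)"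
proof -
  have "(\<Sum>n\<le>N. ito_part u v n) = (\<Sum>n\<le>length u + length v. ito_part u v n)"
    by (rule sum.mono_neutral_right) (use assms in \<open>auto simp: ito_part_def ito_pairs_large\<close>)
  also have "\<dots> = ito_mult u v" unfolding ito_mult_def ito_part_def ito_pairs_def ..
  finally show ?thesis ..
qed

lemma card_below_lt:
  fixes A :: "nat set"
  assumes "A \<subseteq> {..<n}" "i \<in> A"
  shows "card {j \<in> A. j < i} < card A"
proof (rule psubset_card_mono)
  show "finite A" by (rule finite_subset[OF assms(1)]) simp
  show "{j \<in> A. j < i} \<subset> A" using assms(2) by blast
qed

text \<open>\<open>C\<close> and \<open>D\<close> record which of the two words occupies the new
  last place \<open>n\<close>. Entries at earlier places count only the places below them, so
  neither this choice nor the appended letters affect them.\<close>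

lemma ito_entry_append:
  assumes "A \<subseteq> {..<n}" "card A = length u" "B \<subseteq> {..<n}" "card B = length v"
    "C \<subseteq> {n}" "D \<subseteq> {n}" "i < n" "i \<in> A \<union> B"
  shows "ito_entry (u @ u') (A \<union> C) (v @ v') (B \<union> D) i = ito_entry u A v B i"
proof -
  have eq: "{j \<in> A \<union> C. j < i} = {j \<in> A. j < i}" "{j \<in> B \<union> D. j < i} = {j \<in> B. j < i}"
    "i \<in> A \<union> C \<longleftrightarrow> i \<in> A" "i \<in> B \<union> D \<longleftrightarrow> i \<in> B"
    using assms by auto
  show ?thesis
    using card_below_lt[OF assms(1), of i] card_below_lt[OF assms(3), of i] assms
    unfolding ito_entry_def Let_def eq by (auto simp: nth_append)
qed

lemma ito_entry_last:
  assumes "A \<subseteq> {..<n}" "B \<subseteq> {..<n}" "C \<subseteq> {n}" "D \<subseteq> {n}"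
  shows "ito_entry u (A \<union> C) v (B \<union> D) n =
    (if n \<in> C then (if n \<in> D then u ! card A * v ! card B else u ! card A) else v ! card B)"
proof -
  have eq: "{j \<in> A \<union> C. j < n} = A" "{j \<in> B \<union> D. j < n} = B"
    "n \<in> A \<union> C \<longleftrightarrow> n \<in> C" "n \<in> B \<union> D \<longleftrightarrow> n \<in> D"
    using assms by auto
  show ?thesis unfolding ito_entry_def Let_def eq by simp
qed

text \<open>Pairs are sorted by whether the last place \<open>n\<close> belongs to \<open>A\<close>
  alone, to \<open>B\<close> alone or to both. The unions with the empty set give the three images
  the common shape used in \<open>sum_ito_pairs_image\<close>.\<close>

lemma ito_pairs_Suc:
  "ito_pairs (Suc p) (Suc q) (Suc n) =
     (\<lambda>(A, B). (A \<union> {n}, B \<union> {})) ` ito_pairs p (Suc q) n \<union>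
     (\<lambda>(A, B). (A \<union> {}, B \<union> {n})) ` ito_pairs (Suc p) q n \<union>
     (\<lambda>(A, B). (A \<union> {n}, B \<union> {n})) ` ito_pairs p q n" (is "?l = ?r1 \<union> ?r2 \<union> ?r3")
proof (intro equalityI subsetI)
  fix X assume "X \<in> ?l"
  then obtain A B where X: "X = (A, B)" and U: "A \<union> B = {..<Suc n}"
    and c: "card A = Suc p" "card B = Suc q"
    by (auto simp: ito_pairs_def)
  have fin: "finite A" "finite B" using c by (simp_all add: card_ge_0_finite)
  have U': "(A - {n}) \<union> (B - {n}) = {..<n}"
    using U by (metis Un_Diff lessThan_Suc_eq_insert_0 lessThan_Suc Diff_insert_absorb lessThan_iff less_irrefl)
  have n: "n \<in> A \<union> B" using U by simp
  consider "n \<in> A" "n \<notin> B" | "n \<notin> A" "n \<in> B" | "n \<in> A" "n \<in> B" using n by blast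
  then show "X \<in> ?r1 \<union> ?r2 \<union> ?r3"
  proof cases
    case 1
    have "(A - {n}, B) \<in> ito_pairs p (Suc q) n" using c U' fin 1 by (simp add: ito_pairs_def)
    moreover have "X = (\<lambda>(A, B). (A \<union> {n}, B \<union> {})) (A - {n}, B)" using 1 X by auto
    ultimately have "X \<in> ?r1" by (rule rev_image_eqI)
    then show ?thesis by blast
  next
    case 2
    have "(A, B - {n}) \<in> ito_pairs (Suc p) q n" using c U' fin 2 by (simp add: ito_pairs_def)
    moreover have "X = (\<lambda>(A, B). (A \<union> {}, B \<union> {n})) (A, B - {n})" using 2 X by auto
    ultimately have "X \<in> ?r2" by (rule rev_image_eqI)
    then show ?thesis by blast
  next
    case 3
    have "(A - {n}, B - {n}) \<in> ito_pairs p q n" using c U' fin 3 by (simp add: ito_pairs_def)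
    moreover have "X = (\<lambda>(A, B). (A \<union> {n}, B \<union> {n})) (A - {n}, B - {n})" using 3 X by auto
    ultimately have "X \<in> ?r3" by (rule rev_image_eqI)
    then show ?thesis by blast
  qed
next
  have *: "finite A \<and> finite B \<and> n \<notin> A \<and> n \<notin> B" if "A \<union> B = {..<n}" for A B :: "nat set"
    using that by (metis UnCI finite_Un finite_lessThan lessThan_iff less_irrefl)
  fix X assume "X \<in> ?r1 \<union> ?r2 \<union> ?r3"
  then consider (1) A B where "X = (A \<union> {n}, B)" "(A, B) \<in> ito_pairs p (Suc q) n"
    | (2) A B where "X = (A, B \<union> {n})" "(A, B) \<in> ito_pairs (Suc p) q n"
    | (3) A B where "X = (A \<union> {n}, B \<union> {n})" "(A, B) \<in> ito_pairs p q n"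
    by auto
  then show "X \<in> ?l"
  proof cases
    case 1
    with *[of A B] show ?thesis by (auto simp: ito_pairs_def lessThan_Suc)
  next
    case 2
    with *[of A B] show ?thesis by (auto simp: ito_pairs_def lessThan_Suc)
  next
    case 3
    with *[of A B] show ?thesis by (auto simp: ito_pairs_def lessThan_Suc)
  qed
qed

text \<open>Treats the three classes of \<open>ito_pairs_Suc\<close> at once. The letters in
  \<open>u'\<close> and \<open>v'\<close> are those consumed at place \<open>n\<close>, and
  \<open>z\<close> is the resulting entry, which therefore ends every word of the class.\<close>

lemma sum_ito_pairs_image:
  assumes C: "C \<subseteq> {n}" and D: "D \<subseteq> {n}"
    and last: "\<And>A B. (A, B) \<in> ito_pairs (length u) (length v) n \<Longrightarrow>
      ito_entry (u @ u') (A \<union> C) (v @ v') (B \<union> D) n = z"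
  shows "(\<Sum>(A, B)\<in>(\<lambda>(A, B). (A \<union> C, B \<union> D)) ` ito_pairs (length u) (length v) n.
      gen (map (ito_entry (u @ u') A (v @ v') B) [0..<Suc n])) =
    (lin_ext (\<lambda>w. gen (w @ [z])) (ito_part u v n) :: 'l::ring list \<Rightarrow>\<^sub>0 'k::field)"
    (is "sum ?t (?f ` ?P) = _")
proof -
  have sub: "A \<subseteq> {..<n}" "B \<subseteq> {..<n}" "n \<notin> A" "n \<notin> B" "card A = length u" "card B = length v"
    "A \<union> B = {..<n}"
    if "(A, B) \<in> ?P" for A B
    using that by (auto simp: ito_pairs_def)
  have "inj_on ?f ?P"
  proof (rule inj_onI)
    fix P Q assume PQ: "P \<in> ?P" "Q \<in> ?P" "?f P = ?f Q"
    obtain A B A' B' where AB: "P = (A, B)" "Q = (A', B')" by force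
    have "A \<union> C = A' \<union> C" "B \<union> D = B' \<union> D" using PQ(3) AB by auto
    moreover have "n \<notin> A" "n \<notin> B" "n \<notin> A'" "n \<notin> B'" using sub(3,4) PQ(1,2) AB by auto
    ultimately have "A = A'" "B = B'" using C D by blast+
    then show "P = Q" using AB by simp
  qed
  then have "sum ?t (?f ` ?P) = (\<Sum>P\<in>?P. ?t (?f P))"
    by (simp only: sum.reindex o_def)
  also have "\<dots> = (\<Sum>(A, B)\<in>?P.
      lin_ext (\<lambda>w. gen (w @ [z])) (gen (map (ito_entry u A v B) [0..<n])))"
  proof (rule sum.cong[OF refl])
    fix P assume "P \<in> ?P"
    moreover obtain A B where AB: "P = (A, B)" by force
    ultimately have P: "(A, B) \<in> ?P" by simp
    have "ito_entry (u @ u') (A \<union> C) (v @ v') (B \<union> D) i = ito_entry u A v B i" if "i < n" for i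
      by (rule ito_entry_append[OF sub(1)[OF P] sub(5)[OF P] sub(2)[OF P] sub(6)[OF P] C D that])
        (use sub(7)[OF P] that in simp)
    then have "map (ito_entry (u @ u') (A \<union> C) (v @ v') (B \<union> D)) [0..<n] =
        map (ito_entry u A v B) [0..<n]"
      by simp
    then show "?t (?f P) = (case P of (A, B) \<Rightarrow>
        lin_ext (\<lambda>w. gen (w @ [z])) (gen (map (ito_entry u A v B) [0..<n])))"
      by (simp add: AB last[OF P] del: map_eq_conv)
  qed
  also have "\<dots> = lin_ext (\<lambda>w. gen (w @ [z])) (ito_part u v n)"
    unfolding ito_part_def lin_ext_sum by (rule sum.cong) auto
  finally show ?thesis .
qed

lemma ito_part_snoc:
  "ito_part (u @ [x]) (v @ [y]) (Suc n) =
     (lin_ext (\<lambda>w. gen (w @ [x])) (ito_part u (v @ [y]) n) +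
      lin_ext (\<lambda>w. gen (w @ [y])) (ito_part (u @ [x]) v n) +
      lin_ext (\<lambda>w. gen (w @ [x * y])) (ito_part u v n) :: 'l::ring list \<Rightarrow>\<^sub>0 'k::field)"
proof -
  let ?p = "length u" and ?q = "length v"
  let ?f = "\<lambda>C D (A, B). (A \<union> C, B \<union> D) :: nat set \<times> nat set"
  let ?t = "\<lambda>(A, B). gen (map (ito_entry (u @ [x]) A (v @ [y]) B) [0..<Suc n]) :: 'l list \<Rightarrow>\<^sub>0 'k"
  let ?r1 = "?f {n} {} ` ito_pairs ?p (Suc ?q) n"
  let ?r2 = "?f {} {n} ` ito_pairs (Suc ?p) ?q n"
  let ?r3 = "?f {n} {n} ` ito_pairs ?p ?q n"
  have sub: "A \<subseteq> {..<n}" "B \<subseteq> {..<n}" "n \<notin> A" "n \<notin> B" "card A = p" "card B = q"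
    if "(A, B) \<in> ito_pairs p q n" for A B p q
    using that by (auto simp: ito_pairs_def)
  have "ito_part (u @ [x]) (v @ [y]) (Suc n) = sum ?t (?r1 \<union> ?r2 \<union> ?r3)"
    unfolding ito_part_def by (simp only: ito_pairs_Suc length_append_singleton)
  also have "\<dots> = sum ?t ?r1 + sum ?t ?r2 + sum ?t ?r3"
  proof -
    have "n \<in> fst P \<and> n \<notin> snd P" if "P \<in> ?r1" for P using that sub(4) by fastforce
    moreover have "n \<notin> fst P \<and> n \<in> snd P" if "P \<in> ?r2" for P using that sub(3) by fastforce
    moreover have "n \<in> fst P \<and> n \<in> snd P" if "P \<in> ?r3" for P using that by force
    ultimately have "?r1 \<inter> ?r2 = {}" "(?r1 \<union> ?r2) \<inter> ?r3 = {}" by blast+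
    moreover have "finite ?r1" "finite ?r2" "finite ?r3" by (simp_all only: finite_ito_pairs finite_imageI)
    ultimately show ?thesis by (simp only: sum.union_disjoint finite_Un)
  qed
  also have "sum ?t ?r1 = lin_ext (\<lambda>w. gen (w @ [x])) (ito_part u (v @ [y]) n)"
  proof (rule sum_ito_pairs_image[of "{n}" n "{}" "u" "v @ [y]" "[x]" "[]" "x",
        unfolded append_Nil2 length_append_singleton])
    fix A B assume "(A, B) \<in> ito_pairs ?p (Suc ?q) n"
    note s = sub[OF this]
    show "ito_entry (u @ [x]) (A \<union> {n}) (v @ [y]) (B \<union> {}) n = x"
      by (subst ito_entry_last) (use s in auto)
  qed simp_all
  also have "sum ?t ?r2 = lin_ext (\<lambda>w. gen (w @ [y])) (ito_part (u @ [x]) v n)"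
  proof (rule sum_ito_pairs_image[of "{}" n "{n}" "u @ [x]" "v" "[]" "[y]" "y",
        unfolded append_Nil2 length_append_singleton])
    fix A B assume "(A, B) \<in> ito_pairs (Suc ?p) ?q n"
    note s = sub[OF this]
    show "ito_entry (u @ [x]) (A \<union> {}) (v @ [y]) (B \<union> {n}) n = y"
      by (subst ito_entry_last) (use s in auto)
  qed simp_all
  also have "sum ?t ?r3 = lin_ext (\<lambda>w. gen (w @ [x * y])) (ito_part u v n)"
  proof (rule sum_ito_pairs_image[of "{n}" n "{n}" "u" "v" "[x]" "[y]" "x * y",
        unfolded append_Nil2 length_append_singleton])
    fix A B assume "(A, B) \<in> ito_pairs ?p ?q n"
    note s = sub[OF this]
    show "ito_entry (u @ [x]) (A \<union> {n}) (v @ [y]) (B \<union> {n}) n = x * y"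
      by (subst ito_entry_last) (use s in auto)
  qed simp_all
  finally show ?thesis .
qed

text \<open>The quasi-shuffle recursion: the last place is filled by the first word, by the second,
  or by both. It is run from the end of the words because \<open>word_image\<close> also splits off
  its last copy.\<close>

lemma ito_mult_snoc:
  "ito_mult (u @ [x]) (v @ [y]) =
     lin_ext (\<lambda>w. gen (w @ [x])) (ito_mult u (v @ [y])) +
     lin_ext (\<lambda>w. gen (w @ [y])) (ito_mult (u @ [x]) v) +
     lin_ext (\<lambda>w. gen (w @ [x * y])) (ito_mult u v)"
proof -
  let ?N = "length u + length v + 1"
  \<comment> \<open>Two nonempty words have no part of rank 0, so the summation index can be shifted
    to \<open>Suc n\<close>. The total length is \<open>Suc ?N\<close>, and after the shift
    \<open>?N\<close> bounds the lengths of all three shorter products.\<close>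
  have 0: "ito_part (u @ [x]) (v @ [y]) 0 = 0"
  proof -
    have "ito_pairs (Suc p) q 0 = {}" for p q by (auto simp: ito_pairs_def)
    then show ?thesis unfolding ito_part_def by simp
  qed
  have "ito_mult (u @ [x]) (v @ [y]) = (\<Sum>n\<le>?N. ito_part (u @ [x]) (v @ [y]) (Suc n))"
  proof -
    have "ito_mult (u @ [x]) (v @ [y]) = (\<Sum>n\<le>Suc ?N. ito_part (u @ [x]) (v @ [y]) n)"
      by (rule ito_mult_eq_part) simp
    then show ?thesis unfolding sum.atMost_Suc_shift 0 by simp
  qed
  also have "\<dots> = lin_ext (\<lambda>w. gen (w @ [x])) (\<Sum>n\<le>?N. ito_part u (v @ [y]) n) +
     lin_ext (\<lambda>w. gen (w @ [y])) (\<Sum>n\<le>?N. ito_part (u @ [x]) v n) +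
     lin_ext (\<lambda>w. gen (w @ [x * y])) (\<Sum>n\<le>?N. ito_part u v n)"
    unfolding ito_part_snoc sum.distrib lin_ext_sum ..
  also have "(\<Sum>n\<le>?N. ito_part u (v @ [y]) n) = ito_mult u (v @ [y])"
    by (rule ito_mult_eq_part[symmetric]) simp
  also have "(\<Sum>n\<le>?N. ito_part (u @ [x]) v n) = ito_mult (u @ [x]) v"
    by (rule ito_mult_eq_part[symmetric]) simp
  also have "(\<Sum>n\<le>?N. ito_part u v n) = ito_mult u v"
    by (rule ito_mult_eq_part[symmetric]) simp
  finally show ?thesis .
qed

lemma ito_mult_Nil_left [simp]: "ito_mult [] v = gen v"
proof -
  have pairs: "ito_pairs 0 (length v) n = (if n = length v then {({}, {..<n})} else {})" for n
  proof (intro equalityI subsetI)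
    fix P assume "P \<in> ito_pairs 0 (length v) n"
    then obtain A B where P: "P = (A, B)" "A \<union> B = {..<n}" "card A = 0" "card B = length v"
      by (auto simp: ito_pairs_def)
    \<comment> \<open>Finiteness comes from \<open>A \<union> B = {..<n}\<close>;
      \<open>card A = 0\<close> alone would also allow an infinite \<open>A\<close>.\<close>
    have "finite A" by (rule finite_subset[of _ "{..<n}"]) (use P(2) in auto)
    with P(3) have "A = {}" by simp
    with P(2,4) have "B = {..<n}" "n = length v" by auto
    with \<open>A = {}\<close> P(1) show "P \<in> (if n = length v then {({}, {..<n})} else {})" by simp
  qed (auto simp: ito_pairs_def split: if_splits)
  have entry: "map (ito_entry [] {} v {..<n}) [0..<n] = v" if "n = length v" for n
  proof (rule nth_equalityI)
    fix i assume "i < length (map (ito_entry [] {} v {..<n}) [0..<n])"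
    then have "i < n" by simp
    then have "{j \<in> {..<n}. j < i} = {..<i}" by auto
    with \<open>i < n\<close> show "map (ito_entry [] {} v {..<n}) [0..<n] ! i = v ! i"
      by (simp add: ito_entry_def)
  qed (simp add: that)
  have part: "ito_part [] v n = (if n = length v then gen v else 0)" for n
    unfolding ito_part_def list.size pairs by (auto simp: entry simp del: map_eq_conv)
  have "ito_mult [] v = (\<Sum>n\<le>length v. ito_part [] v n)"
    by (rule ito_mult_eq_part) simp
  then show ?thesis unfolding part by simp
qed

lemma ito_mult_Nil_right [simp]: "ito_mult u [] = gen u"
proof -
  have pairs: "ito_pairs (length u) 0 n = (if n = length u then {({..<n}, {})} else {})" for n
  proof (intro equalityI subsetI)
    fix P assume "P \<in> ito_pairs (length u) 0 n"
    then obtain A B where P: "P = (A, B)" "A \<union> B = {..<n}" "card B = 0" "card A = length u"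
      by (auto simp: ito_pairs_def)
    have "finite B" by (rule finite_subset[of _ "{..<n}"]) (use P(2) in auto)
    with P(3) have "B = {}" by simp
    with P(2,4) have "A = {..<n}" "n = length u" by auto
    with \<open>B = {}\<close> P(1) show "P \<in> (if n = length u then {({..<n}, {})} else {})" by simp
  qed (auto simp: ito_pairs_def split: if_splits)
  have entry: "map (ito_entry u {..<n} [] {}) [0..<n] = u" if "n = length u" for n
  proof (rule nth_equalityI)
    fix i assume "i < length (map (ito_entry u {..<n} [] {}) [0..<n])"
    then have "i < n" by simp
    then have "{j \<in> {..<n}. j < i} = {..<i}" by auto
    with \<open>i < n\<close> show "map (ito_entry u {..<n} [] {}) [0..<n] ! i = u ! i"
      by (simp add: ito_entry_def)
  qed (simp add: that)
  have part: "ito_part u [] n = (if n = length u then gen u else 0)" for n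
    unfolding ito_part_def list.size pairs by (auto simp: entry simp del: map_eq_conv)
  have "ito_mult u [] = (\<Sum>n\<le>length u. ito_part u [] n)"
    by (rule ito_mult_eq_part) simp
  then show ?thesis unfolding part by simp
qed


section \<open>The monoid algebra of placed letters\<close>

text \<open>The multiplicative semigroup of L with an identity adjoined. It is written additively
  since a product of monomials in \<open>Poly_Mapping\<close> adds their exponents; functions into
  it then form a monoid place by place.\<close>

datatype 'a unitized = Adj_One | Elem 'a

instantiation unitized :: (semigroup_mult) monoid_add
begin

definition zero_unitized :: "'a unitized" where
  "zero_unitized = Adj_One"

fun plus_unitized :: "'a unitized \<Rightarrow> 'a unitized \<Rightarrow> 'a unitized" where
  "plus_unitized Adj_One y = y"
| "plus_unitized (Elem x) Adj_One = Elem x"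
| "plus_unitized (Elem x) (Elem y) = Elem (x * y)"

instance
proof
  fix a b c :: "'a unitized"
  show "a + b + c = a + (b + c)"
    by (cases a; cases b; cases c) (simp_all add: mult.assoc)
  show "0 + a = a" by (simp add: zero_unitized_def)
  show "a + 0 = a" by (cases a) (simp_all add: zero_unitized_def)
qed

end

lemma Elem_neq_0 [simp]: "Elem x \<noteq> 0" "0 \<noteq> Elem x"
  by (simp_all add: zero_unitized_def)

type_synonym 'l places = "nat \<times> nat \<Rightarrow> 'l unitized"

definition supported :: "(nat \<times> nat) set \<Rightarrow> ('l::ring places \<Rightarrow>\<^sub>0 'k::field) \<Rightarrow> bool" where
  "supported S f \<longleftrightarrow> (\<forall>h\<in>Poly_Mapping.keys f. \<forall>i. i \<notin> S \<longrightarrow> h i = 0)"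

lemma supported_mono: "supported S f \<Longrightarrow> S \<subseteq> T \<Longrightarrow> supported T f"
  by (auto simp: supported_def)

lemma supported_0 [simp]: "supported S 0"
  by (simp add: supported_def)

lemma supported_1 [simp]: "supported S 1"
  by (simp add: supported_def)

lemma supported_add: "supported S f \<Longrightarrow> supported S g \<Longrightarrow> supported S (f + g)"
  using keys_add[of f g] by (auto simp: supported_def)

lemma supported_fscale: "supported S f \<Longrightarrow> supported S (fscale c f)"
  using keys_fscale_subset[of c f] by (auto simp: supported_def)

lemma supported_sum: "(\<And>i. i \<in> X \<Longrightarrow> supported S (F i)) \<Longrightarrow> supported S (\<Sum>i\<in>X. F i)"
  by (induction X rule: infinite_finite_induct) (auto intro: supported_add)

lemma supported_lin_ext: "(\<And>g. supported S (\<phi> g)) \<Longrightarrow> supported S (lin_ext \<phi> f)"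
  unfolding lin_ext_def by (intro supported_sum supported_fscale)

lemma supported_mult: "supported S f \<Longrightarrow> supported S g \<Longrightarrow> supported S (f * g)"
  using keys_mult[of f g] by (fastforce simp: supported_def)

text \<open>At every place at least one of the two monomials has the unit. All later exchanges of
  factors go back to this rule.\<close>

lemma supported_mult_commute:
  assumes "supported S f" "supported T g" "S \<inter> T = {}"
  shows "f * g = g * f"
proof -
  have "f * g = lin_ext (\<lambda>a. lin_ext (\<lambda>b. gen a * gen b) g) f"
    using lin_ext_mult[of gen f gen g] by (simp only: lin_ext_id)
  also have "\<dots> = lin_ext (\<lambda>a. lin_ext (\<lambda>b. gen b * gen a) g) f"
  proof (intro lin_ext_cong)
    fix a b assume ab: "a \<in> Poly_Mapping.keys f" "b \<in> Poly_Mapping.keys g"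
    have "a + b = b + a"
    proof
      fix i
      have "i \<notin> S \<or> i \<notin> T" using assms(3) by blast
      then have "a i = 0 \<or> b i = 0" using assms(1,2) ab unfolding supported_def by blast
      then show "(a + b) i = (b + a) i" by auto
    qed
    then show "gen a * gen b = (gen b * gen a :: 'a places \<Rightarrow>\<^sub>0 'b)" by (simp add: mult_single)
  qed
  also have "\<dots> = g * f"
    using lin_ext_mult[of gen g gen f] by (simp only: lin_ext_id lin_ext_swap[of _ _ g])
  finally show ?thesis .
qed

section \<open>Placing words in finitely many copies of L\<close>

definition letter :: "nat \<times> nat \<Rightarrow> 'l::ring \<Rightarrow> ('l places \<Rightarrow>\<^sub>0 'k::field)" where
  "letter i x = gen (\<lambda>j. if j = i then Elem x else 0)"

lemma letter_mult: "letter i x * letter i y = letter i (x * y)"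
  by (auto simp: letter_def mult_single intro!: arg_cong[where f = gen])

lemma supported_letter: "i \<in> S \<Longrightarrow> supported S (letter i x)"
  by (auto simp: supported_def letter_def)

text \<open>The recursion asks for the content of the last copy \<open>(p, N)\<close>: either the
  unit, or a letter, which must then be the last one of \<open>u\<close> since positions increase.
  Too few copies give 0.\<close>

primrec word_image :: "nat \<Rightarrow> nat \<Rightarrow> 'l::ring list \<Rightarrow> ('l places \<Rightarrow>\<^sub>0 'k::field)" where
  "word_image p 0 u = (if u = [] then 1 else 0)"
| "word_image p (Suc N) u = word_image p N u +
     (if u = [] then 0 else word_image p N (butlast u) * letter (p, N) (last u))"

lemma word_image_Nil [simp]: "word_image p N [] = 1"
  by (induction N) auto

lemma word_image_snoc:
  "word_image p (Suc N) (u @ [x]) = word_image p N (u @ [x]) + word_image p N u * letter (p, N) x"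
  by simp

lemma supported_word_image: "{p} \<times> {..<N} \<subseteq> S \<Longrightarrow> supported S (word_image p N u)"
proof (induction N arbitrary: u)
  case (Suc N)
  then have "{p} \<times> {..<N} \<subseteq> S" "(p, N) \<in> S" by auto
  with Suc.IH show ?case
    by (auto intro!: supported_add supported_mult supported_letter)
qed simp

lemma word_image_letter_commute:
  "i \<notin> {p} \<times> {..<N} \<Longrightarrow> word_image p N u * letter i x = letter i x * word_image p N u"
  by (rule supported_mult_commute[of "{p} \<times> {..<N}" _ "{i}"])
    (auto intro: supported_word_image supported_letter)

lemma lin_ext_word_image_Suc:
  "lin_ext (word_image p (Suc N)) (lin_ext (\<lambda>w. gen (w @ [x])) f) =
     lin_ext (word_image p N) (lin_ext (\<lambda>w. gen (w @ [x])) f) +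
     lin_ext (word_image p N) f * letter (p, N) x"
  by (simp add: lin_ext_lin_ext word_image_snoc lin_ext_fun_add lin_ext_times_right
      del: word_image.simps)

text \<open>In \<open>Suc N\<close> copies each image is \<open>J u + J u' * x\<close>, with
  \<open>u'\<close> the word without its last letter. Multiplying out the two images gives four
  terms according to which last letters sit in copy \<open>N\<close>; when both do, they merge into
  the letter \<open>x * y\<close>, as in \<open>ito_mult_snoc\<close>.\<close>

lemma word_image_ito_mult:
  "lin_ext (word_image p N) (ito_mult u v) =
     (word_image p N u * word_image p N v :: 'l::ring places \<Rightarrow>\<^sub>0 'k::field)"
proof (induction N arbitrary: u v)
  case 0
  show ?case
  proof (cases u rule: rev_cases)
    case Nil
    then show ?thesis by simp
  next
    case (snoc u' x)
    show ?thesis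
    proof (cases v rule: rev_cases)
      case Nil
      then show ?thesis by simp
    next
      case (snoc v' y)
      with \<open>u = u' @ [x]\<close> show ?thesis
        by (simp add: ito_mult_snoc lin_ext_add lin_ext_lin_ext)
    qed
  qed
next
  case (Suc N)
  show ?case
  proof (cases u rule: rev_cases)
    case Nil
    then show ?thesis by (simp del: word_image.simps)
  next
    case u: (snoc u' x)
    show ?thesis
    proof (cases v rule: rev_cases)
      case Nil
      then show ?thesis by (simp del: word_image.simps)
    next
      case v: (snoc v' y)
      let ?J = "word_image p N :: 'l list \<Rightarrow> ('l places \<Rightarrow>\<^sub>0 'k)" and ?x = "letter (p, N) x" and ?y = "letter (p, N) y"
      have c: "?J w * (?x * z) = ?x * (?J w * z)" for w z
        unfolding mult.assoc[symmetric] by (simp add: word_image_letter_commute)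
      \<comment> \<open>The parts that leave copy \<open>N\<close> empty recombine, by the same
        recursion, into the image of \<open>ito_mult u v\<close> in \<open>N\<close> copies.\<close>
      have "lin_ext (word_image p (Suc N)) (ito_mult u v) =
        lin_ext ?J (ito_mult u v) + lin_ext ?J (ito_mult u' v) * ?x +
        lin_ext ?J (ito_mult u v') * ?y + lin_ext ?J (ito_mult u' v') * letter (p, N) (x * y)"
        unfolding u v ito_mult_snoc
        by (simp only: lin_ext_add lin_ext_word_image_Suc ac_simps)
      also have "\<dots> = ?J u * ?J v + ?J u' * (?x * ?J v) + ?J u * ?J v' * ?y +
          ?J u' * ?x * (?J v' * ?y)"
        by (simp add: Suc.IH letter_mult[symmetric] mult.assoc c[of v' ?y]
            word_image_letter_commute[of "(p, N)" p N v x])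
      also have "\<dots> = word_image p (Suc N) u * word_image p (Suc N) v"
        unfolding u v word_image_snoc by (simp add: algebra_simps)
      finally show ?thesis .
    qed
  qed
qed


section \<open>Faithful placements of presented algebras\<close>

context fin_dim_algebra
begin

definition linear_mod :: "('h \<Rightarrow>\<^sub>0 'k) set \<Rightarrow> ('l \<Rightarrow> ('h \<Rightarrow>\<^sub>0 'k)) \<Rightarrow> bool" where
  "linear_mod V g \<longleftrightarrow> (\<forall>x y. g (x + y) - g x - g y \<in> V) \<and>
     (\<forall>c x. g (scale c x) - fscale c (g x) \<in> V)"

lemma linear_mod_0 [simp]: "fs.subspace V \<Longrightarrow> linear_mod V (\<lambda>x. 0)"
  by (simp add: linear_mod_def fs.subspace_0)

lemma linear_mod_gen: "e \<in> E \<Longrightarrow> linear_mod (linearity_rels scale E) (\<lambda>x. gen (e x))"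
  unfolding linear_mod_def linearity_rels_def
  by (intro conjI allI fs.span_base, rule UnI1, blast, rule UnI2, blast)

lemma subspace_linearity_rels: "fs.subspace (linearity_rels scale E)"
  unfolding linearity_rels_def by (rule fs.subspace_span)

text \<open>The universal property of the presentations. L, its unitization, T(L) and the place
  algebra are all presented by \<open>linearity_rels\<close>, so this one statement checks that maps
  out of any of them respect the relations.\<close>

lemma lin_ext_linearity_rels:
  assumes "fs.subspace V" "\<And>e. e \<in> E \<Longrightarrow> linear_mod V (\<lambda>x. \<phi> (e x))"
    "f \<in> linearity_rels scale E"
  shows "lin_ext \<phi> f \<in> V"
proof (rule lin_ext_span_subspace[OF assms(1) _ assms(3)[unfolded linearity_rels_def]])
  fix g assume "g \<in> {gen (e (x + y)) - gen (e x) - gen (e y) |e x y. e \<in> E} \<union>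
     {gen (e (scale c x)) - fscale c (gen (e x)) |e c x. e \<in> E}"
  then show "lin_ext \<phi> g \<in> V"
    using assms(2) by (auto simp: lin_ext_diff lin_ext_fscale linear_mod_def)
qed

lemma linear_mod_ftensor_left:
  "linear_mod (rels A) g \<Longrightarrow> linear_mod (rels (A \<otimes> B)) (\<lambda>x. ftensor (g x) f)"
  unfolding linear_mod_def
  by (simp add: ftensor_rels_left flip: ftensor_diff_left ftensor_fscale_left)

lemma linear_mod_ftensor_right:
  "linear_mod (rels B) g \<Longrightarrow> linear_mod (rels (A \<otimes> B)) (\<lambda>x. ftensor f (g x))"
  unfolding linear_mod_def
  by (simp add: ftensor_rels_right flip: ftensor_diff_right ftensor_fscale_right)

text \<open>In the monoid algebra the letters x, y and x + y are unrelated; dividing by these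
  relations turns a family of letters into a tensor, multilinear in its occupied places.\<close>

definition place_ideal :: "('l places \<Rightarrow>\<^sub>0 'k) set" where
  "place_ideal = linearity_rels scale {\<lambda>x. h(i := Elem x) | h i. True}"

lemma subspace_place_ideal: "fs.subspace place_ideal"
  unfolding place_ideal_def by (rule subspace_linearity_rels)

lemma linear_mod_place: "linear_mod place_ideal (\<lambda>x. gen (h(i := Elem x)))"
  unfolding place_ideal_def by (rule linear_mod_gen) blast

lemma linear_mod_compose:
  assumes "linear_mod V g" "\<And>x y. t (x + y) = t x + t y" "\<And>c x. t (scale c x) = scale c (t x)"
  shows "linear_mod V (\<lambda>x. g (t x))"
  using assms by (simp add: linear_mod_def)

text \<open>At place \<open>i\<close> the monomial \<open>m\<close> has either the unit or a letter
  \<open>z\<close>, and multiplication by \<open>z\<close> is linear in L. Together with the mirror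
  statement this makes the relations a two-sided ideal.\<close>

lemma linear_mod_add_left: "linear_mod place_ideal (\<lambda>x. gen (m + h(i := Elem x)))"
proof (cases "m i")
  case Adj_One
  then have "m + h(i := Elem x) = (m + h)(i := Elem x)" for x by auto
  then show ?thesis by (simp only: linear_mod_place)
next
  case (Elem z)
  then have "m + h(i := Elem x) = (m + h)(i := Elem (z * x))" for x by auto
  then show ?thesis
    by (simp only:)
      (rule linear_mod_compose[OF linear_mod_place],
        simp_all add: distrib_left scale_mult_right)
qed

lemma linear_mod_add_right: "linear_mod place_ideal (\<lambda>x. gen (h(i := Elem x) + m))"
proof (cases "m i")
  case Adj_One
  then have "h(i := Elem x) + m = (h + m)(i := Elem x)" for x by auto
  then show ?thesis by (simp only: linear_mod_place)
next
  case (Elem z)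
  then have "h(i := Elem x) + m = (h + m)(i := Elem (x * z))" for x by auto
  then show ?thesis
    by (simp only:)
      (rule linear_mod_compose[OF linear_mod_place],
        simp_all add: distrib_right scale_mult_left)
qed

lemma place_ideal_mult_left: "f \<in> place_ideal \<Longrightarrow> y * f \<in> place_ideal"
proof -
  assume f: "f \<in> place_ideal"
  have "y * f = lin_ext (\<lambda>m. lin_ext (\<lambda>h. gen (m + h)) f) y"
    using lin_ext_mult[of gen y gen f] by (simp add: lin_ext_id mult_single)
  also have "\<dots> \<in> place_ideal"
    by (intro lin_ext_in_subspace subspace_place_ideal
        lin_ext_linearity_rels[OF _ _ f[unfolded place_ideal_def]])
      (auto intro: linear_mod_add_left)
  finally show ?thesis .
qed

lemma place_ideal_mult_right: "f \<in> place_ideal \<Longrightarrow> f * y \<in> place_ideal"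
proof -
  assume f: "f \<in> place_ideal"
  have "f * y = lin_ext (\<lambda>m. lin_ext (\<lambda>h. gen (h + m)) f) y"
    using lin_ext_mult[of gen f gen y] by (simp add: lin_ext_id mult_single lin_ext_swap[of _ y])
  also have "\<dots> \<in> place_ideal"
    by (intro lin_ext_in_subspace subspace_place_ideal
        lin_ext_linearity_rels[OF _ _ f[unfolded place_ideal_def]])
      (auto intro: linear_mod_add_right)
  finally show ?thesis .
qed

lemma linear_mod_letter: "linear_mod place_ideal (letter i)"
proof -
  have "(letter i :: 'l \<Rightarrow> ('l places \<Rightarrow>\<^sub>0 'k)) = (\<lambda>x. gen ((0::'l places)(i := Elem x)))"
    unfolding letter_def by (intro ext arg_cong[where f = gen]) auto
  then show ?thesis by (simp only: linear_mod_place)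
qed

lemma linear_mod_mult_left: "linear_mod place_ideal g \<Longrightarrow> linear_mod place_ideal (\<lambda>x. y * g x)"
  unfolding linear_mod_def
  by (simp add: place_ideal_mult_left flip: right_diff_distrib fscale_mult_right)

lemma linear_mod_mult_right: "linear_mod place_ideal g \<Longrightarrow> linear_mod place_ideal (\<lambda>x. g x * y)"
  unfolding linear_mod_def
  by (simp add: place_ideal_mult_right flip: left_diff_distrib fscale_mult_left)

lemma linear_mod_plus:
  assumes V: "fs.subspace V" and "linear_mod V g" "linear_mod V g'"
  shows "linear_mod V (\<lambda>x. g x + g' x)"
proof -
  have "g (x + y) + g' (x + y) - (g x + g' x) - (g y + g' y) \<in> V" for x y
  proof -
    have "g (x + y) + g' (x + y) - (g x + g' x) - (g y + g' y) =
      (g (x + y) - g x - g y) + (g' (x + y) - g' x - g' y)" by simp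
    then show ?thesis using assms fs.subspace_add[OF V] by (simp only: linear_mod_def)
  qed
  moreover have "g (scale c x) + g' (scale c x) - fscale c (g x + g' x) \<in> V" for c x
  proof -
    have "g (scale c x) + g' (scale c x) - fscale c (g x + g' x) =
      (g (scale c x) - fscale c (g x)) + (g' (scale c x) - fscale c (g' x))"
      by (simp add: fs.scale_right_distrib)
    then show ?thesis using assms fs.subspace_add[OF V] by (simp only: linear_mod_def)
  qed
  ultimately show ?thesis by (simp add: linear_mod_def)
qed

text \<open>Injectivity modulo relations is witnessed by a left inverse: \<open>b s\<close> reads off the generators of
  rank \<open>s\<close> from the monomials of their images and annihilates the images of all others.\<close>

definition extractor ::
  "('g, 'k) presented_algebra \<Rightarrow> (nat \<times> nat) set \<Rightarrow> ('s \<Rightarrow> 'g \<Rightarrow> ('l places \<Rightarrow>\<^sub>0 'k)) \<Rightarrow>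
    ('s \<Rightarrow> 'l places \<Rightarrow> ('g \<Rightarrow>\<^sub>0 'k)) \<Rightarrow> ('g \<Rightarrow> 's) \<Rightarrow> bool" where
  "extractor A S \<alpha> b rk \<longleftrightarrow>
    (\<forall>s h h'. (\<forall>i\<in>S. h i = h' i) \<longrightarrow> b s h = b s h') \<and>
    (\<forall>s h. \<forall>i\<in>S. linear_mod (rels A) (\<lambda>x. b s (h(i := Elem x)))) \<and>
    (\<forall>s g. lin_ext (b s) (\<alpha> s g) = (if s = rk g then gen g else 0))"

lemma
  assumes "extractor A S \<alpha> b rk"
  shows extractor_local: "(\<And>i. i \<in> S \<Longrightarrow> h i = h' i) \<Longrightarrow> b s h = b s h'"
    and extractor_linear: "i \<in> S \<Longrightarrow> linear_mod (rels A) (\<lambda>x. b s (h(i := Elem x)))"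
    and extractor_inverse: "lin_ext (b s) (\<alpha> s g) = (if s = rk g then gen g else 0)"
  using assms unfolding extractor_def by simp_all

text \<open>A jointly faithful family of homomorphisms into the place algebra. The index
  \<open>s\<close> is the number of copies for T(L) and trivial for L and its unitization. Products
  are preserved exactly, before any relation is divided out; only the relations are compared modulo
  \<open>place_ideal\<close>.\<close>

definition placement ::
  "('g, 'k) presented_algebra \<Rightarrow> (nat \<times> nat) set \<Rightarrow> ('s \<Rightarrow> 'g \<Rightarrow> ('l places \<Rightarrow>\<^sub>0 'k)) \<Rightarrow> bool" where
  "placement A S \<alpha> \<longleftrightarrow> fs.subspace (rels A) \<and>
    (\<forall>s g g'. lin_ext (\<alpha> s) (gmult A g g') = \<alpha> s g * \<alpha> s g') \<and>
    (\<forall>s g. supported S (\<alpha> s g)) \<and>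
    (\<forall>s. \<forall>f\<in>rels A. lin_ext (\<alpha> s) f \<in> place_ideal) \<and>
    (\<exists>b rk. extractor A S \<alpha> b rk)"

lemma
  assumes "placement A S \<alpha>"
  shows placement_subspace: "fs.subspace (rels A)"
    and placement_gmult: "lin_ext (\<alpha> s) (gmult A g g') = \<alpha> s g * \<alpha> s g'"
    and placement_supported: "supported S (\<alpha> s g)"
    and placement_rels: "f \<in> rels A \<Longrightarrow> lin_ext (\<alpha> s) f \<in> place_ideal"
    and placement_extractor: "\<exists>b rk. extractor A S \<alpha> b rk"
  using assms by (simp_all add: placement_def)

text \<open>A left inverse applied to the image with index \<open>s\<close> returns the part of
  \<open>f\<close> of rank \<open>s\<close>. Linearity of the inverse sends
  \<open>place_ideal\<close> to relations, so each such part is a relation, and \<open>f\<close> is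
  the sum over the finitely many ranks that occur in it.\<close>

lemma placement_detects:
  assumes pl: "placement A S \<alpha>" and f: "\<And>s. lin_ext (\<alpha> s) f \<in> place_ideal"
  shows "f \<in> rels A"
proof -
  note V = placement_subspace[OF pl]
  obtain b rk where e: "extractor A S \<alpha> b rk"
    using placement_extractor[OF pl] by blast
  note b = extractor_local[OF e] and lin = extractor_linear[OF e] and inv = extractor_inverse[OF e]
  \<comment> \<open>A place outside S on which b ignores the letter would break linearity, so such monomials
    are sent to 0.\<close>
  define b' where "b' s h = (if \<forall>i. i \<notin> S \<longrightarrow> h i = 0 then b s h else 0)" for s h
  have inv': "lin_ext (b' s) (\<alpha> s g) = (if s = rk g then gen g else 0)" for s g
  proof -
    have "lin_ext (b' s) (\<alpha> s g) = lin_ext (b s) (\<alpha> s g)"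
      using placement_supported[OF pl, of s g]
      by (intro lin_ext_cong) (simp add: b'_def supported_def)
    then show ?thesis by (simp add: inv)
  qed
  have lin': "linear_mod (rels A) (\<lambda>x. b' s (h(i := Elem x)))" for s h i
  proof (cases "i \<in> S \<and> (\<forall>j. j \<notin> S \<longrightarrow> h j = 0)")
    case True
    then have "b' s (h(i := Elem x)) = b s (h(i := Elem x))" for x
      by (auto simp: b'_def)
    then show ?thesis using lin[of i s h] True by simp
  next
    case False
    have "b' s (h(i := Elem x)) = 0" for x
    proof (cases "i \<in> S")
      case True
      with False obtain j where "j \<notin> S" "h j \<noteq> 0" "j \<noteq> i" by auto
      then have "\<not> (\<forall>j. j \<notin> S \<longrightarrow> (h(i := Elem x)) j = 0)" by (metis fun_upd_other)
      then show ?thesis unfolding b'_def by (simp only: if_False)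
    next
      case False
      then have "\<not> (\<forall>j. j \<notin> S \<longrightarrow> (h(i := Elem x)) j = 0)" by (metis fun_upd_same Elem_neq_0(1))
      then show ?thesis unfolding b'_def by (simp only: if_False)
    qed
    then show ?thesis by (simp add: V)
  qed
  have "lin_ext (b' s) (lin_ext (\<alpha> s) f) \<in> rels A" for s
    by (rule lin_ext_linearity_rels[OF V _ f[unfolded place_ideal_def]]) (auto intro: lin')
  then have "(\<Sum>s\<in>rk ` Poly_Mapping.keys f. lin_ext (b' s) (lin_ext (\<alpha> s) f)) \<in> rels A"
    by (intro fs.subspace_sum V)
  also have "(\<Sum>s\<in>rk ` Poly_Mapping.keys f. lin_ext (b' s) (lin_ext (\<alpha> s) f)) = lin_ext gen f"
    (is "sum ?F ?R = _")
  proof -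
    let ?c = "Poly_Mapping.lookup f"
    have "sum ?F ?R = (\<Sum>s\<in>?R. \<Sum>g\<in>Poly_Mapping.keys f. if s = rk g then fscale (?c g) (gen g) else 0)"
    proof (rule sum.cong[OF refl])
      fix s
      have "?F s = lin_ext (\<lambda>g. if s = rk g then gen g else 0) f"
        unfolding lin_ext_lin_ext inv' ..
      also have "\<dots> = (\<Sum>g\<in>Poly_Mapping.keys f. if s = rk g then fscale (?c g) (gen g) else 0)"
        unfolding lin_ext_def by (rule sum.cong) auto
      finally show "?F s = \<dots>" .
    qed
    also have "\<dots> = (\<Sum>g\<in>Poly_Mapping.keys f. \<Sum>s\<in>?R. if s = rk g then fscale (?c g) (gen g) else 0)"
      by (rule sum.swap)
    also have "\<dots> = (\<Sum>g\<in>Poly_Mapping.keys f. fscale (?c g) (gen g))"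
      by (rule sum.cong) auto
    finally show ?thesis unfolding lin_ext_def .
  qed
  finally show ?thesis by (simp add: lin_ext_id)
qed

lemma placement_rels_iff:
  "placement A S \<alpha> \<Longrightarrow> f \<in> rels A \<longleftrightarrow> (\<forall>s. lin_ext (\<alpha> s) f \<in> place_ideal)"
  by (auto intro: placement_detects placement_rels)

definition pair_place :: "('s \<Rightarrow> 'a \<Rightarrow> ('l places \<Rightarrow>\<^sub>0 'k)) \<Rightarrow> ('t \<Rightarrow> 'b \<Rightarrow> ('l places \<Rightarrow>\<^sub>0 'k)) \<Rightarrow>
    's \<times> 't \<Rightarrow> 'a \<times> 'b \<Rightarrow> ('l places \<Rightarrow>\<^sub>0 'k)" where
  "pair_place \<alpha> \<beta> = (\<lambda>(s, t) (a, b). \<alpha> s a * \<beta> t b)"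

lemma pair_place_apply [simp]: "pair_place \<alpha> \<beta> (s, t) (a, b) = \<alpha> s a * \<beta> t b"
  by (simp add: pair_place_def)

lemma pair_place_ftensor:
  "lin_ext (pair_place \<alpha> \<beta> (s, t)) (ftensor f g) = lin_ext (\<alpha> s) f * lin_ext (\<beta> t) g"
  unfolding pair_place_def by (simp add: lin_ext_ftensor_mult)

text \<open>Left inverses pass to tensor products: in a product of a monomial on \<open>S\<close>
  and one on \<open>T\<close> the first inverse sees only the former and the second only the latter.
  Writing a letter at one place changes only one of the two tensor factors, which gives
  linearity.\<close>

lemma extractor_tensor:
  assumes "extractor A S \<alpha> bA rkA" "extractor B T \<beta> bB rkB" "S \<inter> T = {}"
    and supp: "\<And>s g. supported S (\<alpha> s g)" "\<And>t g. supported T (\<beta> t g)"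
  shows "extractor (A \<otimes> B) (S \<union> T) (pair_place \<alpha> \<beta>)
    (\<lambda>(s, t) h. ftensor (bA s h) (bB t h)) (\<lambda>(a, b). (rkA a, rkB b))"
proof -
  note A = extractor_local[OF assms(1)] extractor_linear[OF assms(1)]
    extractor_inverse[OF assms(1)]
  note B = extractor_local[OF assms(2)] extractor_linear[OF assms(2)]
    extractor_inverse[OF assms(2)]
  have 1: "ftensor (bA s h) (bB t h) = ftensor (bA s h') (bB t h')"
    if "\<forall>i\<in>S \<union> T. h i = h' i" for s t h h'
    using A(1)[of h h' s] B(1)[of h h' t] that by simp
  have 2: "linear_mod (rels (A \<otimes> B)) (\<lambda>x. ftensor (bA s (h(i := Elem x))) (bB t (h(i := Elem x))))"
    if "i \<in> S \<union> T" for s t h i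
  proof (cases "i \<in> S")
    case True
    then have "bB t (h(i := Elem x)) = bB t h" for x
      using assms(3) by (intro B(1)) auto
    then show ?thesis using A(2)[OF True] by (simp add: linear_mod_ftensor_left)
  next
    case False
    then have "bA s (h(i := Elem x)) = bA s h" for x
      using assms(3) by (intro A(1)) auto
    then show ?thesis using B(2)[of i t h] False that by (simp add: linear_mod_ftensor_right)
  qed
  have 3: "lin_ext (\<lambda>h. ftensor (bA s h) (bB t h)) (\<alpha> s a * \<beta> t b) =
    (if s = rkA a \<and> t = rkB b then gen (a, b) else 0)" for s t a b
  proof -
    have "lin_ext (\<lambda>h. ftensor (bA s h) (bB t h)) (\<alpha> s a * \<beta> t b) =
      lin_ext (\<lambda>h. lin_ext (\<lambda>k. ftensor (bA s (h + k)) (bB t (h + k))) (\<beta> t b)) (\<alpha> s a)"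
      using lin_ext_mult[of gen "\<alpha> s a" gen "\<beta> t b"]
      by (simp add: lin_ext_id mult_single lin_ext_lin_ext)
    also have "\<dots> = lin_ext (\<lambda>h. lin_ext (\<lambda>k. ftensor (bA s h) (bB t k)) (\<beta> t b)) (\<alpha> s a)"
    proof (intro lin_ext_cong)
      fix h k assume hk: "h \<in> Poly_Mapping.keys (\<alpha> s a)" "k \<in> Poly_Mapping.keys (\<beta> t b)"
      have "bA s (h + k) = bA s h"
      proof (rule A(1))
        fix i assume "i \<in> S"
        then have "i \<notin> T" using assms(3) by blast
        then have "k i = 0" using hk(2) supp(2) unfolding supported_def by blast
        then show "(h + k) i = h i" by simp
      qed
      moreover have "bB t (h + k) = bB t k"
      proof (rule B(1))
        fix i assume "i \<in> T"
        then have "i \<notin> S" using assms(3) by blast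
        then have "h i = 0" using hk(1) supp(1) unfolding supported_def by blast
        then show "(h + k) i = k i" by simp
      qed
      ultimately show "ftensor (bA s (h + k)) (bB t (h + k)) = ftensor (bA s h) (bB t k)" by simp
    qed
    also have "\<dots> = ftensor (lin_ext (bA s) (\<alpha> s a)) (lin_ext (bB t) (\<beta> t b))"
      by (simp only: ftensor_lin_ext)
    finally show ?thesis by (simp add: A(3) B(3))
  qed
  show ?thesis
    unfolding extractor_def using 1 2 3 by (auto simp: pair_place_def)
qed

text \<open>Componentwise multiplication is preserved because images with disjoint supports commute;
  the relations are preserved because \<open>place_ideal\<close> is two-sided.\<close>

lemma placement_tensor:
  assumes A: "placement A S \<alpha>" and B: "placement B T \<beta>" and ST: "S \<inter> T = {}"
  shows "placement (A \<otimes> B) (S \<union> T) (pair_place \<alpha> \<beta>)"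
proof -
  have comm: "\<alpha> s a * \<beta> t b = \<beta> t b * \<alpha> s a" for s t a b
    by (rule supported_mult_commute[OF placement_supported[OF A] placement_supported[OF B] ST])
  have "fs.subspace (rels (A \<otimes> B))"
    by (simp add: alg_tensor_def fs.subspace_span)
  moreover have "lin_ext (pair_place \<alpha> \<beta> st) (gmult (A \<otimes> B) g g') =
      pair_place \<alpha> \<beta> st g * pair_place \<alpha> \<beta> st g'" for st g g'
  proof -
    obtain s t a b a' b' where eq: "st = (s, t)" "g = (a, b)" "g' = (a', b')" by (metis surj_pair)
    have "\<alpha> s a * \<alpha> s a' * (\<beta> t b * \<beta> t b') = \<alpha> s a * (\<alpha> s a' * \<beta> t b) * \<beta> t b'"
      by (simp add: mult.assoc)
    also have "\<alpha> s a' * \<beta> t b = \<beta> t b * \<alpha> s a'" by (rule comm)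
    also have "\<alpha> s a * (\<beta> t b * \<alpha> s a') * \<beta> t b' = \<alpha> s a * \<beta> t b * (\<alpha> s a' * \<beta> t b')"
      by (simp add: mult.assoc)
    finally show ?thesis
      by (simp add: eq alg_tensor_def pair_place_ftensor placement_gmult[OF A] placement_gmult[OF B])
  qed
  moreover have "supported (S \<union> T) (pair_place \<alpha> \<beta> st g)" for st g
    by (cases st; cases g) (auto intro!: supported_mult
        intro: supported_mono[OF placement_supported[OF A]] supported_mono[OF placement_supported[OF B]])
  moreover have "lin_ext (pair_place \<alpha> \<beta> st) f \<in> place_ideal" if "f \<in> rels (A \<otimes> B)" for st f
  proof (rule lin_ext_span_subspace[OF subspace_place_ideal])
    show "f \<in> fspan ({ftensor f (gen b) |f b. f \<in> rels A} \<union> {ftensor (gen a) f |a f. f \<in> rels B})"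
      using that by (simp add: alg_tensor_def)
    fix z assume "z \<in> {ftensor f (gen b) |f b. f \<in> rels A} \<union> {ftensor (gen a) f |a f. f \<in> rels B}"
    then consider f b where "z = ftensor f (gen b)" "f \<in> rels A"
      | a f where "z = ftensor (gen a) f" "f \<in> rels B"
      by blast
    then show "lin_ext (pair_place \<alpha> \<beta> st) z \<in> place_ideal"
    proof cases
      case 1
      then show ?thesis
        by (cases st) (auto simp: pair_place_ftensor
            intro!: place_ideal_mult_right placement_rels[OF A])
    next
      case 2
      then show ?thesis
        by (cases st) (auto simp: pair_place_ftensor
            intro!: place_ideal_mult_left placement_rels[OF B])
    qed
  qed
  moreover have "\<exists>b rk. extractor (A \<otimes> B) (S \<union> T) (pair_place \<alpha> \<beta>) b rk"
  proof -
    obtain bA rkA bB rkB where "extractor A S \<alpha> bA rkA" "extractor B T \<beta> bB rkB"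
      using placement_extractor[OF A] placement_extractor[OF B] by blast
    from extractor_tensor[OF this ST placement_supported[OF A] placement_supported[OF B]]
    show ?thesis by blast
  qed
  ultimately show ?thesis by (simp add: placement_def)
qed

end


section \<open>Placements of T(L), of L and of its unitization\<close>

fun the_Elem :: "'a unitized \<Rightarrow> 'a" where
  "the_Elem (Elem x) = x"

text \<open>This and the next two lemmas compare the length of the word with the number of copies.
  Only when they agree is there a monomial occupying all \<open>N\<close> copies, and then it is
  unique and spells the word.\<close>

lemma word_image_long:
  "N < length u \<Longrightarrow> word_image p N u = (0 :: 'l::ring places \<Rightarrow>\<^sub>0 'k::field)"
proof (induction N arbitrary: u)
  case (Suc N)
  show ?case using Suc.IH[of u] Suc.IH[of "butlast u"] Suc.prems by simp
qed auto

lemma word_image_exact: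
  "length u = N \<Longrightarrow> word_image p N u =
    (gen (\<lambda>(q, j). if q = p \<and> j < N then Elem (u ! j) else 0) :: 'l::ring places \<Rightarrow>\<^sub>0 'k::field)"
proof (induction N arbitrary: u)
  case 0
  then show ?case by (simp add: zero_fun_def flip: single_one)
next
  case (Suc N)
  then obtain v x where u: "u = v @ [x]" and v: "length v = N"
    by (metis length_Suc_conv_rev)
  have "word_image p (Suc N) u = (word_image p N v * letter (p, N) x :: 'l places \<Rightarrow>\<^sub>0 'k)"
    unfolding u word_image_snoc by (simp add: word_image_long v)
  also have "\<dots> = gen ((\<lambda>(q, j). if q = p \<and> j < N then Elem (v ! j) else 0) +
      (\<lambda>j. if j = (p, N) then Elem x else 0))"
    unfolding Suc.IH[OF v] letter_def mult_single by simp
  also have "(\<lambda>(q, j). if q = p \<and> j < N then Elem (v ! j) else 0) +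
      (\<lambda>j. if j = (p, N) then Elem x else 0) =
    (\<lambda>(q, j). if q = p \<and> j < Suc N then Elem (u ! j) else 0)"
    using v by (auto simp: u nth_append less_Suc_eq)
  finally show ?case .
qed

lemma word_image_short:
  "length u < N \<Longrightarrow>
    h \<in> Poly_Mapping.keys (word_image p N u :: 'l::ring places \<Rightarrow>\<^sub>0 'k::field) \<Longrightarrow>
    \<exists>j<N. h (p, j) = 0"
proof (induction N arbitrary: u h)
  case (Suc N)
  let ?J = "word_image p N :: 'l list \<Rightarrow> ('l places \<Rightarrow>\<^sub>0 'k)"
  let ?t = "if u = [] then 0 else ?J (butlast u) * letter (p, N) (last u)"
  from Suc.prems(2) have "h \<in> Poly_Mapping.keys (?J u + ?t)" by simp
  with keys_add[of "?J u" ?t] consider "h \<in> Poly_Mapping.keys (?J u)" | "h \<in> Poly_Mapping.keys ?t"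
    by blast
  then show ?case
  proof cases
    case 1
    then have "h (p, N) = 0"
      using supported_word_image[of p N "{p} \<times> {..<N}" u] unfolding supported_def by blast
    then show ?thesis by auto
  next
    case 2
    then have u: "u \<noteq> []" by auto
    with 2 have "h \<in> Poly_Mapping.keys (?J (butlast u) * letter (p, N) (last u))" by simp
    with keys_mult[of "?J (butlast u)" "letter (p, N) (last u)"]
    obtain a where a: "a \<in> Poly_Mapping.keys (?J (butlast u))"
      and h: "h = a + (\<lambda>j. if j = (p, N) then Elem (last u) else 0)"
      by (auto simp: letter_def)
    have "length (butlast u) < N" using u Suc.prems(1) by (cases u) auto
    from Suc.IH[OF this a] obtain j where "j < N" "a (p, j) = 0" by auto
    with h show ?thesis by (auto intro!: exI[of _ j])
  qed
qed simp

context fin_dim_algebra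
begin

text \<open>The marked letter is either the last one, hence placed directly by
  \<open>letter\<close>, or it stays in the word when the last letter is split off. The induction
  therefore runs over arbitrary \<open>v\<close>.\<close>

lemma linear_mod_word_image: "linear_mod place_ideal (\<lambda>x. word_image p N (u @ x # v))"
proof (induction N arbitrary: v)
  case 0
  then show ?case by (simp add: subspace_place_ideal)
next
  case (Suc N)
  show ?case
  proof (cases v rule: rev_cases)
    case Nil
    show ?thesis unfolding Nil word_image_snoc
      by (intro linear_mod_plus subspace_place_ideal linear_mod_mult_left linear_mod_letter
          Suc.IH[of "[]"])
  next
    case (snoc v' y)
    have "linear_mod place_ideal (\<lambda>x. word_image p N (u @ x # v) +
        word_image p N (u @ x # v') * letter (p, N) y)"
      by (intro linear_mod_plus subspace_place_ideal linear_mod_mult_right Suc.IH)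
    moreover have "word_image p (Suc N) (u @ x # v) =
        (word_image p N (u @ x # v) + word_image p N (u @ x # v') * letter (p, N) y :: 'l places \<Rightarrow>\<^sub>0 'k)"
      for x
      using word_image_snoc[of p N "u @ x # v'" y] by (simp add: snoc del: word_image.simps)
    ultimately show ?thesis by (simp only:)
  qed
qed

lemma placement_T: "placement (alg_T scale) ({p} \<times> UNIV) (word_image p)"
proof -
  \<comment> \<open>All copies of factor \<open>p\<close> are tested, also those from
    \<open>N\<close> on. A letter there must give 0: if it were ignored, \<open>b N\<close> would be
    constant in that letter and not linear.\<close>
  define b :: "nat \<Rightarrow> 'l places \<Rightarrow> ('l list \<Rightarrow>\<^sub>0 'k)" where
    "b N h = (if \<forall>j. h (p, j) \<noteq> 0 \<longleftrightarrow> j < N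
      then gen (map (\<lambda>j. the_Elem (h (p, j))) [0..<N]) else 0)" for N h
  have 1: "b N h = b N h'" if "\<forall>i\<in>{p} \<times> UNIV. h i = h' i" for N h h'
  proof -
    have "h (p, j) = h' (p, j)" for j using that by simp
    then show ?thesis unfolding b_def by (simp only:)
  qed
  have 2: "linear_mod (rels (alg_T scale)) (\<lambda>x. b N (h(i := Elem x)))"
    if ip: "i \<in> {p} \<times> UNIV" for N h i
  proof -
    obtain j where i: "i = (p, j)" using ip by blast
    show ?thesis
    \<comment> \<open>The condition says that writing a letter at copy \<open>j\<close> completes
      the set of occupied copies to those below \<open>N\<close>; what \<open>h\<close> had at
      \<open>j\<close> is overwritten.\<close>
    proof (cases "j < N \<and> (\<forall>k. k \<noteq> j \<longrightarrow> (h (p, k) \<noteq> 0 \<longleftrightarrow> k < N))")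
      case True
      let ?u = "map (\<lambda>k. the_Elem (h (p, k))) [0..<j]"
      let ?v = "map (\<lambda>k. the_Elem (h (p, k))) [Suc j..<N]"
      have "b N (h(i := Elem x)) = gen (?u @ x # ?v)" for x
      proof -
        have "[0..<N] = [0..<j] @ j # [Suc j..<N]"
          using True by (metis le_add1 less_imp_le upt_add_eq_append le_add_diff_inverse add_0 upt_conv_Cons)
        moreover have "\<forall>k. (h(i := Elem x)) (p, k) \<noteq> 0 \<longleftrightarrow> k < N"
          using True by (simp add: i)
        moreover have "map (\<lambda>k. the_Elem ((h(i := Elem x)) (p, k))) [0..<j] = ?u"
          "map (\<lambda>k. the_Elem ((h(i := Elem x)) (p, k))) [Suc j..<N] = ?v"
          "the_Elem ((h(i := Elem x)) (p, j)) = x"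
          by (simp_all add: i)
        ultimately show ?thesis unfolding b_def by (simp only: simp_thms if_True map_append list.map)
      qed
      moreover have "linear_mod (rels (alg_T scale)) (\<lambda>x. gen (?u @ x # ?v))"
        unfolding alg_T_def presented_algebra.select_convs by (rule linear_mod_gen) blast
      ultimately show ?thesis by simp
    next
      case False
      have "\<not> (\<forall>k. (h(i := Elem x)) (p, k) \<noteq> 0 \<longleftrightarrow> k < N)" for x
      proof
        assume *: "\<forall>k. (h(i := Elem x)) (p, k) \<noteq> 0 \<longleftrightarrow> k < N"
        have "j < N" using *[rule_format, of j] by (simp add: i)
        moreover have "h (p, k) \<noteq> 0 \<longleftrightarrow> k < N" if "k \<noteq> j" for k
          using *[rule_format, of k] that by (simp add: i)
        ultimately show False using False by blast
      qed
      then have "b N (h(i := Elem x)) = 0" for x unfolding b_def by (simp only: if_False)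
      then show ?thesis by (simp add: alg_T_def subspace_linearity_rels)
    qed
  qed
  have 3: "lin_ext (b N) (word_image p N u) = (if N = length u then gen u else 0)" for N u
  proof -
    consider "N < length u" | "N = length u" | "length u < N" by linarith
    then show ?thesis
    proof cases
      case 1
      then show ?thesis by (simp add: word_image_long)
    next
      case 2
      have "map (\<lambda>j. the_Elem (if j < N then Elem (u ! j) else 0)) [0..<N] = u"
        using 2 by (intro nth_equalityI) auto
      then show ?thesis
        using 2 by (simp add: word_image_exact b_def zero_unitized_def[symmetric] cong: map_cong)
    next
      case 3
      have "lin_ext (b N) (word_image p N u) = lin_ext (\<lambda>_. 0) (word_image p N u)"
      proof (intro lin_ext_cong)
        fix h assume "h \<in> Poly_Mapping.keys (word_image p N u :: 'l places \<Rightarrow>\<^sub>0 'k)"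
        from word_image_short[OF 3 this] obtain j where "j < N" "h (p, j) = 0" by blast
        then show "b N h = 0" by (auto simp: b_def)
      qed
      with 3 show ?thesis by simp
    qed
  qed
  have "extractor (alg_T scale) ({p} \<times> UNIV) (word_image p) b length"
    unfolding extractor_def by (intro conjI allI impI ballI 1 2 3) (rule bspec)
  moreover have "lin_ext (word_image p N) f \<in> place_ideal" if "f \<in> rels (alg_T scale)" for N f
    using that unfolding alg_T_def presented_algebra.select_convs
    by (rule lin_ext_linearity_rels[OF subspace_place_ideal, rotated])
      (auto intro: linear_mod_word_image)
  moreover have "supported ({p} \<times> UNIV) (word_image p N u)" for N u
    by (rule supported_word_image) auto
  ultimately show ?thesis
    unfolding placement_def
    by (auto simp: alg_T_def subspace_linearity_rels word_image_ito_mult)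
qed

lemma placement_L: "placement (alg_L scale) {i} (\<lambda>_::unit. letter i)"
proof -
  \<comment> \<open>Place \<open>i\<close> is occupied in every image of L, so the value 0 at an
    empty place is just a default.\<close>
  define b :: "unit \<Rightarrow> 'l places \<Rightarrow> ('l \<Rightarrow>\<^sub>0 'k)" where
    "b s h = (case h i of Adj_One \<Rightarrow> 0 | Elem x \<Rightarrow> gen x)" for s h
  have lin: "linear_mod (rels (alg_L scale)) (\<lambda>x. gen x)"
    unfolding alg_L_def presented_algebra.select_convs
    using linear_mod_gen[of "\<lambda>x. x" "{\<lambda>x. x}"] by simp
  have "extractor (alg_L scale) {i} (\<lambda>_. letter i) b (\<lambda>_. ())"
    unfolding extractor_def by (simp add: b_def lin letter_def)
  moreover have "lin_ext (letter i) f \<in> place_ideal" if "f \<in> rels (alg_L scale)" for f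
    using that unfolding alg_L_def presented_algebra.select_convs
    by (rule lin_ext_linearity_rels[OF subspace_place_ideal, rotated])
      (simp add: linear_mod_letter)
  ultimately show ?thesis
    unfolding placement_def
    by (auto simp: alg_L_def subspace_linearity_rels letter_mult supported_letter)
qed

definition opt_letter :: "nat \<times> nat \<Rightarrow> 'l option \<Rightarrow> ('l places \<Rightarrow>\<^sub>0 'k)" where
  "opt_letter i a = (case a of None \<Rightarrow> 1 | Some x \<Rightarrow> letter i x)"

lemma opt_letter_simps [simp]: "opt_letter i None = 1" "opt_letter i (Some x) = letter i x"
  by (simp_all add: opt_letter_def)

lemma placement_L1: "placement (alg_L1 scale) {i} (\<lambda>_::unit. opt_letter i)"
proof -
  \<comment> \<open>Here an empty place does occur in an image and reads as the adjoined unit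
    \<open>None\<close>.\<close>
  define b :: "unit \<Rightarrow> 'l places \<Rightarrow> ('l option \<Rightarrow>\<^sub>0 'k)" where
    "b s h = (case h i of Adj_One \<Rightarrow> gen None | Elem x \<Rightarrow> gen (Some x))" for s h
  have lin: "linear_mod (rels (alg_L1 scale)) (\<lambda>x. gen (Some x))"
    unfolding alg_L1_def presented_algebra.select_convs by (rule linear_mod_gen) simp
  have "lin_ext (b s) (opt_letter i a) = gen a" for s a
    by (cases a) (simp_all add: b_def letter_def zero_unitized_def flip: single_one)
  then have "extractor (alg_L1 scale) {i} (\<lambda>_. opt_letter i) b (\<lambda>_. ())"
    unfolding extractor_def by (simp add: b_def lin)
  moreover have "lin_ext (opt_letter i) f \<in> place_ideal" if "f \<in> rels (alg_L1 scale)" for f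
    using that unfolding alg_L1_def presented_algebra.select_convs
    by (rule lin_ext_linearity_rels[OF subspace_place_ideal, rotated])
      (simp add: linear_mod_letter)
  moreover have "lin_ext (opt_letter i) (gmult (alg_L1 scale) a a') = opt_letter i a * opt_letter i a'"
    for a a'
    by (cases a; cases a') (simp_all add: alg_L1_def letter_mult)
  moreover have "supported {i} (opt_letter i a)" for a
    by (cases a) (simp_all add: supported_letter)
  ultimately show ?thesis
    unfolding placement_def by (auto simp: alg_L1_def subspace_linearity_rels)
qed

end


section \<open>Power series modulo the ideal of relations\<close>

definition image_fps :: "('g \<Rightarrow> ('l::ring places \<Rightarrow>\<^sub>0 'k::field)) \<Rightarrow> ('g, 'k) rseries \<Rightarrow>
    ('l places \<Rightarrow>\<^sub>0 'k) fps" where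
  "image_fps \<phi> F = Abs_fps (\<lambda>n. lin_ext \<phi> (F n))"

lemma image_fps_nth [simp]: "fps_nth (image_fps \<phi> F) n = lin_ext \<phi> (F n)"
  by (simp add: image_fps_def)

lemma image_fps_fun_add: "image_fps (\<lambda>g. \<phi> g + \<psi> g) F = image_fps \<phi> F + image_fps \<psi> F"
  by (rule fps_ext) (simp add: lin_ext_fun_add)

lemma image_fps_fun_0 [simp]: "image_fps (\<lambda>g. 0) F = 0"
  by (rule fps_ext) simp

lemma image_fps_cauchy:
  assumes "\<And>a b. lin_ext \<chi> (\<mu> a b) = \<phi> a * \<psi> b"
  shows "image_fps \<chi> (cauchy \<mu> F G) = image_fps \<phi> F * image_fps \<psi> G"
  by (rule fps_ext)
    (simp add: fps_mult_nth cauchy_def lin_ext_sum lin_ext_bilin_ext_mult[OF assms] atMost_atLeast0)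

definition fps_supported :: "(nat \<times> nat) set \<Rightarrow> ('l::ring places \<Rightarrow>\<^sub>0 'k::field) fps \<Rightarrow> bool" where
  "fps_supported S X \<longleftrightarrow> (\<forall>n. supported S (fps_nth X n))"

lemma fps_supported_1 [simp]: "fps_supported S 1"
  by (simp add: fps_supported_def)

lemma fps_supported_add: "fps_supported S X \<Longrightarrow> fps_supported S Y \<Longrightarrow> fps_supported S (X + Y)"
  by (simp add: fps_supported_def supported_add)

lemma fps_supported_mult: "fps_supported S X \<Longrightarrow> fps_supported S Y \<Longrightarrow> fps_supported S (X * Y)"
  by (auto simp: fps_supported_def fps_mult_nth intro!: supported_sum supported_mult)

lemma fps_supported_image: "(\<And>g. supported S (\<phi> g)) \<Longrightarrow> fps_supported S (image_fps \<phi> F)"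
  by (simp add: fps_supported_def supported_lin_ext)

lemma fps_supported_mono: "fps_supported S X \<Longrightarrow> S \<subseteq> T \<Longrightarrow> fps_supported T X"
  unfolding fps_supported_def by (blast intro: supported_mono)

lemma fps_supported_mult_commute:
  assumes "fps_supported S X" "fps_supported T Y" "S \<inter> T = {}"
  shows "X * Y = Y * X"
proof (rule fps_ext)
  fix n
  have "fps_nth (X * Y) n = (\<Sum>i=0..n. fps_nth Y (n - i) * fps_nth X i)"
    unfolding fps_mult_nth
    by (intro sum.cong refl supported_mult_commute[OF _ _ assms(3)])
      (use assms in \<open>simp_all add: fps_supported_def\<close>)
  also have "\<dots> = fps_nth (Y * X) n"
    unfolding fps_mult_nth by (subst sum.atLeastAtMost_rev) (intro sum.cong refl, simp)
  finally show "fps_nth (X * Y) n = fps_nth (Y * X) n" .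
qed

section \<open>Ordered sums and ordered products\<close>

text \<open>The flag tells whether factors with larger index are multiplied on the right or on the left.\<close>

definition mult_dir :: "bool \<Rightarrow> 'a::ring_1 \<Rightarrow> 'a \<Rightarrow> 'a" where
  "mult_dir fwd x y = (if fwd then x * y else y * x)"

text \<open>The ordered elementary symmetric polynomial: the sum over indices j0 < ... < jn < N of
  products of n + 1 factors. The shift by one follows the product integrals, whose summand number n
  has rank n + 1.\<close>

primrec dir_sum :: "bool \<Rightarrow> (nat \<Rightarrow> 'a::ring_1) \<Rightarrow> nat \<Rightarrow> nat \<Rightarrow> 'a" where
  "dir_sum fwd L 0 N = (\<Sum>j<N. L j)"
| "dir_sum fwd L (Suc n) N = (\<Sum>j<N. mult_dir fwd (dir_sum fwd L n j) (L j))"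

primrec dir_prod :: "bool \<Rightarrow> (nat \<Rightarrow> 'a::ring_1) \<Rightarrow> nat \<Rightarrow> 'a" where
  "dir_prod fwd L 0 = 1"
| "dir_prod fwd L (Suc N) = mult_dir fwd (dir_prod fwd L N) (L N)"

lemma dir_sum_eq_0: "N \<le> n \<Longrightarrow> dir_sum fwd L n N = 0"
proof (induction n arbitrary: N)
  case (Suc n)
  have "mult_dir fwd (dir_sum fwd L n j) (L j) = 0" if "j < N" for j
    using Suc.IH[of j] Suc.prems that by (simp add: mult_dir_def)
  then show ?case by simp
qed simp

lemma dir_sum_Suc: "dir_sum fwd L n (Suc N) = dir_sum fwd L n N +
    (case n of 0 \<Rightarrow> L N | Suc m \<Rightarrow> mult_dir fwd (dir_sum fwd L m N) (L N))"
  by (cases n) simp_all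

text \<open>Multiplying out the ordered product: each factor contributes 1 or \<open>L j\<close>,
  and the terms are collected by the number of chosen factors.\<close>

lemma dir_prod_eq_sum: "dir_prod fwd (\<lambda>j. 1 + L j) N = 1 + (\<Sum>n<N. dir_sum fwd L n N)"
proof (induction N)
  case (Suc N)
  let ?S = "\<Sum>n<N. dir_sum fwd L n N"
  have "(\<Sum>n<Suc N. dir_sum fwd L n (Suc N)) =
      (\<Sum>n<Suc N. dir_sum fwd L n N) + (L N + (\<Sum>n<N. mult_dir fwd (dir_sum fwd L n N) (L N)))"
    unfolding dir_sum_Suc sum.distrib by (subst (2) sum.lessThan_Suc_shift) simp
  also have "(\<Sum>n<Suc N. dir_sum fwd L n N) = ?S" by (simp add: dir_sum_eq_0)
  also have "(\<Sum>n<N. mult_dir fwd (dir_sum fwd L n N) (L N)) = mult_dir fwd ?S (L N)"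
    by (simp add: mult_dir_def sum_distrib_left sum_distrib_right)
  finally show ?case
    by (simp only: dir_prod.simps Suc.IH) (simp add: mult_dir_def algebra_simps)
qed simp

text \<open>Each term has n + 1 factors divisible by h, hence order at least n + 1.\<close>

lemma dir_sum_nth_eq_0:
  assumes "\<And>j. fps_nth (L j) 0 = 0" "i \<le> n"
  shows "fps_nth (dir_sum fwd L n N) i = 0"
  using assms(2)
proof (induction n arbitrary: i N)
  case 0
  then show ?case by (simp add: fps_sum_nth assms(1))
next
  case (Suc n)
  have "fps_nth (mult_dir fwd (dir_sum fwd L n j) (L j)) i = 0" for j
  proof -
    have 1: "fps_nth (dir_sum fwd L n j) a = 0 \<or> fps_nth (L j) (i - a) = 0" if "a \<le> i" for a
    proof (cases "a = i")
      case True
      then show ?thesis by (simp add: assms(1))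
    next
      case False
      with that Suc.prems show ?thesis by (simp add: Suc.IH)
    qed
    have 2: "fps_nth (L j) a = 0 \<or> fps_nth (dir_sum fwd L n j) (i - a) = 0" if "a \<le> i" for a
      using 1[of "i - a"] that by auto
    have "fps_nth (dir_sum fwd L n j * L j) i = 0"
      unfolding fps_mult_nth
    proof (intro sum.neutral ballI)
      fix a assume "a \<in> {0..i}"
      then show "fps_nth (dir_sum fwd L n j) a * fps_nth (L j) (i - a) = 0" using 1[of a] by auto
    qed
    moreover have "fps_nth (L j * dir_sum fwd L n j) i = 0"
      unfolding fps_mult_nth
    proof (intro sum.neutral ballI)
      fix a assume "a \<in> {0..i}"
      then show "fps_nth (L j) a * fps_nth (dir_sum fwd L n j) (i - a) = 0" using 2[of a] by auto
    qed
    ultimately show ?thesis by (cases fwd) (simp_all add: mult_dir_def)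
  qed
  then show ?case by (simp add: fps_sum_nth)
qed

text \<open>Two truncations agree: by degree, as in the product integrals, and by the number
  \<open>N\<close> of copies. Beyond either bound the terms vanish, so both sums extend to
  \<open>max i N\<close>.\<close>

lemma truncated_dir_sum_nth:
  assumes "\<And>j. fps_nth (L j) 0 = 0"
  shows "(\<Sum>n<i. fps_nth (dir_sum fwd L n N) i) = fps_nth (\<Sum>n<N. dir_sum fwd L n N) i"
proof -
  have "(\<Sum>n<i. fps_nth (dir_sum fwd L n N) i) = (\<Sum>n<max i N. fps_nth (dir_sum fwd L n N) i)"
    by (rule sum.mono_neutral_left) (auto simp: dir_sum_nth_eq_0[OF assms])
  also have "\<dots> = (\<Sum>n<N. fps_nth (dir_sum fwd L n N) i)"
    by (rule sum.mono_neutral_right) (auto simp: dir_sum_eq_0)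
  finally show ?thesis by (simp add: fps_sum_nth)
qed

section \<open>Series of cosets and their representatives\<close>

definition coset_series :: "('g, 'k::field) presented_algebra \<Rightarrow> ('g, 'k) rseries \<Rightarrow> ('g, 'k) series" where
  "coset_series A F = (\<lambda>n. cls A (F n))"

lemma series_eq_coset_series: "X \<in> series A \<Longrightarrow> \<exists>F. X = coset_series A F"
proof -
  assume "X \<in> series A"
  then have "\<forall>n. \<exists>f. X n = cls A f" by (auto simp: series_def)
  then obtain F where "\<forall>n. X n = cls A (F n)" by metis
  then show ?thesis unfolding coset_series_def by (intro exI[of _ F] ext) simp
qed

text \<open>The constant coefficient of the representative is made 0 exactly, rather than 0 modulo
  relations. Orders in h can then be counted in the place algebra itself, as
  \<open>dir_sum_nth_eq_0\<close> does.\<close>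

lemma hseries_eq_coset_series:
  assumes "X \<in> hseries A"
  shows "\<exists>F. X = coset_series A F \<and> F 0 = 0"
proof -
  have X: "X \<in> series A" and X0: "X 0 = cls A 0" using assms by (simp_all add: hseries_def)
  obtain F where F: "X = coset_series A F" using series_eq_coset_series[OF X] by blast
  have "X = coset_series A (F(0 := 0))"
    unfolding F coset_series_def by (rule ext) (use X0 in \<open>simp add: F coset_series_def\<close>)
  then show ?thesis by (intro exI[of _ "F(0 := 0)"]) simp
qed

context fin_dim_algebra
begin

definition fps_cong :: "('l places \<Rightarrow>\<^sub>0 'k) fps \<Rightarrow> ('l places \<Rightarrow>\<^sub>0 'k) fps \<Rightarrow> bool"  (infix \<open>\<approx>\<close> 50) where
  "X \<approx> Y \<longleftrightarrow> (\<forall>n. fps_nth (X - Y) n \<in> place_ideal)"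

lemma fps_cong_refl [simp]: "X \<approx> X"
  by (simp add: fps_cong_def fs.subspace_0[OF subspace_place_ideal])

lemma fps_cong_add: "X \<approx> X' \<Longrightarrow> Y \<approx> Y' \<Longrightarrow> X + Y \<approx> X' + Y'"
proof -
  assume "X \<approx> X'" "Y \<approx> Y'"
  moreover have "X + Y - (X' + Y') = (X - X') + (Y - Y')" by simp
  ultimately show ?thesis
    using fs.subspace_add[OF subspace_place_ideal] by (simp only: fps_cong_def fps_add_nth simp_thms)
qed

lemma fps_cong_trans [trans]: "X \<approx> Y \<Longrightarrow> Y \<approx> Z \<Longrightarrow> X \<approx> Z"
proof -
  assume "X \<approx> Y" "Y \<approx> Z"
  then have "fps_nth (X - Y) n + fps_nth (Y - Z) n \<in> place_ideal" for n
    by (simp only: fps_cong_def fs.subspace_add[OF subspace_place_ideal])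
  then show ?thesis unfolding fps_cong_def by simp
qed

lemma fps_cong_mult: "X \<approx> X' \<Longrightarrow> Y \<approx> Y' \<Longrightarrow> X * Y \<approx> X' * Y'"
proof -
  assume X: "X \<approx> X'" and Y: "Y \<approx> Y'"
  have "X * Y - X' * Y' = (X - X') * Y + X' * (Y - Y')" by (simp add: algebra_simps)
  moreover have "fps_nth ((X - X') * Y) n \<in> place_ideal" for n
    unfolding fps_mult_nth
    by (intro fs.subspace_sum[OF subspace_place_ideal] place_ideal_mult_right)
      (use X in \<open>auto simp: fps_cong_def\<close>)
  moreover have "fps_nth (X' * (Y - Y')) n \<in> place_ideal" for n
    unfolding fps_mult_nth
    by (intro fs.subspace_sum[OF subspace_place_ideal] place_ideal_mult_left)
      (use Y in \<open>auto simp: fps_cong_def\<close>)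
  ultimately show ?thesis
    using fs.subspace_add[OF subspace_place_ideal] by (simp only: fps_cong_def fps_add_nth simp_thms)
qed

lemma fps_cong_sum: "(\<And>i. i \<in> K \<Longrightarrow> X i \<approx> Y i) \<Longrightarrow> (\<Sum>i\<in>K. X i) \<approx> (\<Sum>i\<in>K. Y i)"
  by (induction K rule: infinite_finite_induct) (auto intro: fps_cong_add)

lemma fps_cong_dir_sum: "(\<And>j. L j \<approx> L' j) \<Longrightarrow> dir_sum fwd L n N \<approx> dir_sum fwd L' n N"
  by (induction n arbitrary: N)
    (auto simp: mult_dir_def intro!: fps_cong_sum fps_cong_mult)

text \<open>The number of summands varies with the coefficient, so the congruence is checked for
  each coefficient separately.\<close>

lemma fps_cong_truncated:
  assumes "\<And>n. X n \<approx> Y n"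
  shows "Abs_fps (\<lambda>i. \<Sum>n<i. fps_nth (X n) i) \<approx> Abs_fps (\<lambda>i. \<Sum>n<i. fps_nth (Y n) i)"
  unfolding fps_cong_def
proof
  fix i
  have "(\<Sum>n<i. fps_nth (X n - Y n) i) \<in> place_ideal"
    using assms unfolding fps_cong_def by (intro fs.subspace_sum[OF subspace_place_ideal]) blast
  then show "fps_nth (Abs_fps (\<lambda>i. \<Sum>n<i. fps_nth (X n) i) - Abs_fps (\<lambda>i. \<Sum>n<i. fps_nth (Y n) i)) i
      \<in> place_ideal"
    by (simp add: sum_subtractf)
qed

lemma cls_eq_iff:
  assumes "fs.subspace (rels A)"
  shows "cls A f = cls A g \<longleftrightarrow> f - g \<in> rels A"
proof
  assume "cls A f = cls A g"
  moreover have "f \<in> cls A f" using fs.subspace_0[OF assms] by (simp add: cls_def)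
  ultimately have "f \<in> cls A g" by simp
  then show "f - g \<in> rels A" by (simp add: cls_def)
next
  assume fg: "f - g \<in> rels A"
  have "h - f \<in> rels A \<longleftrightarrow> h - g \<in> rels A" for h
  proof
    assume "h - f \<in> rels A"
    from fs.subspace_add[OF assms this fg] show "h - g \<in> rels A" by simp
  next
    assume "h - g \<in> rels A"
    from fs.subspace_diff[OF assms this fg] show "h - f \<in> rels A" by simp
  qed
  then show "cls A f = cls A g" by (simp add: cls_def)
qed

text \<open>The bridge between the quotients and the place algebra. The direction from right to left
  is where faithfulness enters.\<close>

lemma coset_series_eq_iff:
  assumes "placement A S \<alpha>"
  shows "coset_series A F = coset_series A G \<longleftrightarrow> (\<forall>s. image_fps (\<alpha> s) F \<approx> image_fps (\<alpha> s) G)"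
proof -
  have "coset_series A F = coset_series A G \<longleftrightarrow> (\<forall>n. F n - G n \<in> rels A)"
    unfolding fun_eq_iff coset_series_def cls_eq_iff[OF placement_subspace[OF assms]] ..
  then show ?thesis
    unfolding placement_rels_iff[OF assms] by (auto simp: fps_cong_def lin_ext_diff)
qed

lemma reps_coset_series_cong:
  assumes "placement A S \<alpha>" "G \<in> reps (coset_series A F)"
  shows "image_fps (\<alpha> s) G \<approx> image_fps (\<alpha> s) F"
proof -
  have "G n - F n \<in> rels A" for n
    using assms(2) by (simp add: reps_def coset_series_def cls_def)
  then show ?thesis
    using placement_rels[OF assms(1)] by (simp add: fps_cong_def flip: lin_ext_diff)
qed

lemma reps_coset_series_self:
  assumes "placement A S \<alpha>"
  shows "F \<in> reps (coset_series A F)"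
  using fs.subspace_0[OF placement_subspace[OF assms]] by (simp add: reps_def coset_series_def cls_def)

text \<open>The union in \<open>lift1\<close> collapses to one coset: there is a representative, and
  images of different representatives give congruent results. Well-definedness thus becomes a
  congruence in the place algebra.\<close>

lemma lift1_coset_series:
  assumes A: "placement A S \<alpha>" and B: "placement B T \<beta>"
    and cong: "\<And>G t. G \<in> reps (coset_series A F) \<Longrightarrow> image_fps (\<beta> t) (\<Phi> G) \<approx> image_fps (\<beta> t) (\<Phi> F)"
  shows "lift1 B \<Phi> (coset_series A F) = coset_series B (\<Phi> F)"
proof
  fix n
  have "cls B (\<Phi> G n) = cls B (\<Phi> F n)" if "G \<in> reps (coset_series A F)" for G
  proof -
    have "coset_series B (\<Phi> G) = coset_series B (\<Phi> F)"
      unfolding coset_series_eq_iff[OF B] using cong[OF that] by blast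
    from fun_cong[OF this, of n] show ?thesis by (simp only: coset_series_def)
  qed
  then have "lift1 B \<Phi> (coset_series A F) n = (\<Union>G\<in>reps (coset_series A F). cls B (\<Phi> F n))"
    unfolding lift1_def by (intro SUP_cong refl)
  also have "\<dots> = coset_series B (\<Phi> F) n"
    using reps_coset_series_self[OF A, of F] by (auto simp: coset_series_def)
  finally show "lift1 B \<Phi> (coset_series A F) n = coset_series B (\<Phi> F) n" .
qed

lemma lift2_coset_series:
  assumes A: "placement A S \<alpha>" and A': "placement A' S' \<alpha>'" and B: "placement B T \<beta>"
    and cong: "\<And>F' G' t. F' \<in> reps (coset_series A F) \<Longrightarrow> G' \<in> reps (coset_series A' G) \<Longrightarrow>
      image_fps (\<beta> t) (\<Phi> F' G') \<approx> image_fps (\<beta> t) (\<Phi> F G)"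
  shows "lift2 B \<Phi> (coset_series A F) (coset_series A' G) = coset_series B (\<Phi> F G)"
proof
  fix n
  have "cls B (\<Phi> F' G' n) = cls B (\<Phi> F G n)"
    if "F' \<in> reps (coset_series A F)" "G' \<in> reps (coset_series A' G)" for F' G'
  proof -
    have "coset_series B (\<Phi> F' G') = coset_series B (\<Phi> F G)"
      unfolding coset_series_eq_iff[OF B] using cong[OF that] by blast
    from fun_cong[OF this, of n] show ?thesis by (simp only: coset_series_def)
  qed
  then have "lift2 B \<Phi> (coset_series A F) (coset_series A' G) n =
      (\<Union>F'\<in>reps (coset_series A F). \<Union>G'\<in>reps (coset_series A' G). cls B (\<Phi> F G n))"
    unfolding lift2_def by (intro SUP_cong refl)
  also have "\<dots> = coset_series B (\<Phi> F G) n"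
    using reps_coset_series_self[OF A, of F] reps_coset_series_self[OF A', of G]
    by (auto simp: coset_series_def)
  finally show "lift2 B \<Phi> (coset_series A F) (coset_series A' G) n = coset_series B (\<Phi> F G) n" .
qed

lemma image_fps_gmult:
  assumes "placement A S \<alpha>"
  shows "image_fps (\<alpha> s) (cauchy (gmult A) F G) = image_fps (\<alpha> s) F * image_fps (\<alpha> s) G"
  by (rule image_fps_cauchy) (rule placement_gmult[OF assms])

lemma image_fps_add: "image_fps \<phi> (\<lambda>n. F n + G n) = image_fps \<phi> F + image_fps \<phi> G"
  by (rule fps_ext) (simp add: lin_ext_add)

lemma image_fps_rename:
  "image_fps \<phi> (\<lambda>n. lin_ext (\<lambda>g. gen (p g)) (F n)) = image_fps (\<lambda>g. \<phi> (p g)) F"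
  by (rule fps_ext) (simp add: lin_ext_lin_ext)

lemma ser_mult_coset_series:
  assumes "placement A S \<alpha>"
  shows "coset_series A F \<bullet>\<^bsub>A\<^esub> coset_series A G = coset_series A (cauchy (gmult A) F G)"
  unfolding ser_mult_def
  by (rule lift2_coset_series[OF assms assms assms])
    (simp add: image_fps_gmult[OF assms] fps_cong_mult reps_coset_series_cong[OF assms])

lemma ser_add_coset_series:
  assumes "placement A S \<alpha>"
  shows "coset_series A F \<oplus>\<^bsub>A\<^esub> coset_series A G = coset_series A (\<lambda>n. F n + G n)"
  unfolding ser_add_def
  by (rule lift2_coset_series[OF assms assms assms])
    (simp add: image_fps_add fps_cong_add reps_coset_series_cong[OF assms])

text \<open>\<open>sel\<close> keeps those components of the target index that belong to the tensor
  factors actually occupied; the inserted units have image 1.\<close>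

lemma ser_place_coset_series:
  assumes A: "placement A S \<alpha>" and B: "placement B T \<beta>"
    and "\<And>t g. \<beta> t (p g) = \<alpha> (sel t) g"
  shows "ser_place B p (coset_series A F) =
    coset_series B (\<lambda>n. lin_ext (\<lambda>g. gen (p g)) (F n))"
  unfolding ser_place_def
  by (rule lift1_coset_series[OF A B])
    (simp add: image_fps_rename assms(3) reps_coset_series_cong[OF A])

end


section \<open>Images of the product integrals\<close>

lemma image_fps_lin_ext:
  "image_fps \<phi> (\<lambda>n. lin_ext \<psi> (F n)) = image_fps (\<lambda>g. lin_ext \<phi> (\<psi> g)) F"
  by (rule fps_ext) (simp add: lin_ext_lin_ext)

lemma image_fps_truncated:
  "image_fps \<phi> (\<lambda>i. \<Sum>n<i. G n i) = Abs_fps (\<lambda>i. \<Sum>n<i. fps_nth (image_fps \<phi> (G n)) i)"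
  by (rule fps_ext) (simp add: lin_ext_sum)

lemma lin_ext_ftensor_gen_right:
  "lin_ext \<phi> (ftensor f (gen b)) = lin_ext (\<lambda>a. \<phi> (a, b)) f"
  by (simp add: ftensor_gen_right lin_ext_lin_ext)

lemma lin_ext_ftensor_gen_left:
  "lin_ext \<phi> (ftensor (gen a) g) = lin_ext (\<lambda>b. \<phi> (a, b)) g"
  by (simp add: ftensor_gen_left lin_ext_lin_ext)

context fin_dim_algebra
begin

lemma pair_place_eq: "pair_place \<alpha> \<beta> (s, t) = (\<lambda>(a, b). \<alpha> s a * \<beta> t b)"
  by (simp add: pair_place_def)

text \<open>Induction on \<open>n\<close> and then on \<open>N\<close>. Passing to
  \<open>Suc N\<close> copies adds \<open>\<delta> N\<close>, the placements with a letter in copy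
  \<open>N\<close>. That letter is the last one, so it comes from the last factor of the summand,
  while the previous factors use the copies below \<open>N\<close>: this is the recursion of
  \<open>dir_sum\<close>.\<close>

lemma image_left_fwd_summand:
  assumes A: "placement A S \<alpha>" and S: "S \<inter> {q} \<times> UNIV = {}"
  shows "image_fps (pair_place \<alpha> (word_image q) (s, N)) (left_fwd_summand A l n) =
    dir_sum True (\<lambda>j. image_fps (pair_place \<alpha> (\<lambda>_::unit. letter (q, j)) (s, ())) l) n N"
proof -
  let ?chi = "\<lambda>N. pair_place \<alpha> (word_image q) (s, N)"
  let ?L = "\<lambda>j. image_fps (pair_place \<alpha> (\<lambda>_::unit. letter (q, j)) (s, ())) l"
  define \<delta> where "\<delta> N = (\<lambda>(a, w). if w = [] then 0 else
      \<alpha> s a * (word_image q N (butlast w) * letter (q, N) (last w)))" for N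
  have chi_Suc: "image_fps (?chi (Suc N)) G = image_fps (?chi N) G + image_fps (\<delta> N) G" for N G
  proof -
    have "?chi (Suc N) = (\<lambda>g. ?chi N g + \<delta> N g)"
      by (auto simp: \<delta>_def distrib_left)
    then show ?thesis by (simp only: image_fps_fun_add)
  qed
  \<comment> \<open>With no copies only the empty word survives, and every summand has rank at least
    1.\<close>
  have chi_0: "image_fps (?chi 0) (left_fwd_summand A l n) = 0" for n
  proof (cases n)
    case 0
    have "(\<lambda>g. lin_ext (?chi 0) (case g of (a, x) \<Rightarrow> gen (a, [x]))) = (\<lambda>g. 0)" by auto
    then show ?thesis by (simp add: 0 image_fps_lin_ext)
  next
    case (Suc m)
    have "image_fps (?chi 0) (left_fwd_summand A l n) =
        image_fps (\<lambda>_. 0) (left_fwd_summand A l m) * image_fps (\<lambda>_. 0) l"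
      unfolding Suc left_fwd_summand.simps
    proof (rule image_fps_cauchy)
      fix g :: "'a \<times> 'l list" and h :: "'a \<times> 'l"
      show "lin_ext (?chi 0) ((case g of (a, w) \<Rightarrow> \<lambda>(a', x). ftensor (gmult A a a') (gen (w @ [x]))) h) =
          0 * 0"
        by (cases g; cases h) (simp add: lin_ext_ftensor_gen_right)
    qed
    then show ?thesis by simp
  qed
  show ?thesis
  proof (induction n arbitrary: N)
    case 0
    show ?case
    proof (induction N)
      case 0
      then show ?case by (simp add: chi_0 del: left_fwd_summand.simps)
    next
      case (Suc N)
      have "image_fps (\<delta> N) (left_fwd_summand A l 0) = ?L N"
        unfolding left_fwd_summand.simps image_fps_lin_ext
        by (rule arg_cong[where f = "\<lambda>\<phi>. image_fps \<phi> l"]) (auto simp: \<delta>_def)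
      with Suc.IH show ?case by (simp add: chi_Suc del: left_fwd_summand.simps)
    qed
  next
    case n: (Suc n)
    show ?case
    proof (induction N)
      case 0
      then show ?case by (simp add: chi_0 del: left_fwd_summand.simps)
    next
      case (Suc N)
      have "image_fps (\<delta> N) (left_fwd_summand A l (Suc n)) =
          image_fps (?chi N) (left_fwd_summand A l n) * ?L N"
        unfolding left_fwd_summand.simps
      proof (rule image_fps_cauchy)
        fix g :: "'a \<times> 'l list" and h :: "'a \<times> 'l"
        obtain a w a' x where gh: "g = (a, w)" "h = (a', x)" by (metis surj_pair)
        \<comment> \<open>The component in \<open>A\<close> of the new factor has to pass the word
          already placed; \<open>S\<close> contains no place of factor \<open>q\<close>.\<close>
        have "word_image q N w * \<alpha> s a' = \<alpha> s a' * word_image q N w"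
          by (rule supported_mult_commute[OF supported_word_image[OF subset_refl] placement_supported[OF A]])
            (use S in auto)
        then have comm: "word_image q N w * (\<alpha> s a' * y) = \<alpha> s a' * (word_image q N w * y)" for y
          by (simp flip: mult.assoc)
        show "lin_ext (\<delta> N) ((case g of (a, w) \<Rightarrow> \<lambda>(a', x). ftensor (gmult A a a') (gen (w @ [x]))) h) =
            ?chi N g * pair_place \<alpha> (\<lambda>_::unit. letter (q, N)) (s, ()) h"
          by (simp add: gh lin_ext_ftensor_gen_right \<delta>_def placement_gmult[OF A] mult.assoc comm
              flip: lin_ext_times_right)
      qed
      with Suc.IH show ?case
        by (simp add: chi_Suc n.IH mult_dir_def del: left_fwd_summand.simps)
    qed
  qed
qed

lemma image_right_bwd_summand:
  assumes A: "placement A S \<alpha>" and S: "S \<inter> {p} \<times> UNIV = {}"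
  shows "image_fps (pair_place (word_image p) \<alpha> (N, s)) (right_bwd_summand A m n) =
    dir_sum False (\<lambda>i. image_fps (pair_place (\<lambda>_::unit. letter (p, i)) \<alpha> ((), s)) m) n N"
proof -
  let ?chi = "\<lambda>N. pair_place (word_image p) \<alpha> (N, s)"
  let ?L = "\<lambda>i. image_fps (pair_place (\<lambda>_::unit. letter (p, i)) \<alpha> ((), s)) m"
  define \<delta> where "\<delta> N = (\<lambda>(w, a). if w = [] then 0 else
      word_image p N (butlast w) * letter (p, N) (last w) * \<alpha> s a)" for N
  have chi_Suc: "image_fps (?chi (Suc N)) G = image_fps (?chi N) G + image_fps (\<delta> N) G" for N G
  proof -
    have "?chi (Suc N) = (\<lambda>g. ?chi N g + \<delta> N g)"
      by (auto simp: \<delta>_def distrib_right)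
    then show ?thesis by (simp only: image_fps_fun_add)
  qed
  have chi_0: "image_fps (?chi 0) (right_bwd_summand A m n) = 0" for n
  proof (cases n)
    case 0
    have "(\<lambda>g. lin_ext (?chi 0) (case g of (x, a) \<Rightarrow> gen ([x], a))) = (\<lambda>g. 0)" by auto
    then show ?thesis by (simp add: 0 image_fps_lin_ext)
  next
    case (Suc k)
    have "image_fps (?chi 0) (right_bwd_summand A m n) =
        image_fps (\<lambda>_. 0) m * image_fps (\<lambda>_. 0) (right_bwd_summand A m k)"
      unfolding Suc right_bwd_summand.simps
    proof (rule image_fps_cauchy)
      fix g :: "'l \<times> 'a" and h :: "'l list \<times> 'a"
      show "lin_ext (?chi 0) ((case g of (x, a) \<Rightarrow> \<lambda>(w, a'). ftensor (gen (w @ [x])) (gmult A a a')) h) =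
          0 * 0"
        by (cases g; cases h) (simp add: lin_ext_ftensor_gen_left)
    qed
    then show ?thesis by simp
  qed
  show ?thesis
  proof (induction n arbitrary: N)
    case 0
    show ?case
    proof (induction N)
      case 0
      then show ?case by (simp add: chi_0 del: right_bwd_summand.simps)
    next
      case (Suc N)
      have "image_fps (\<delta> N) (right_bwd_summand A m 0) = ?L N"
        unfolding right_bwd_summand.simps image_fps_lin_ext
        by (rule arg_cong[where f = "\<lambda>\<phi>. image_fps \<phi> m"]) (auto simp: \<delta>_def)
      with Suc.IH show ?case by (simp add: chi_Suc del: right_bwd_summand.simps)
    qed
  next
    case n: (Suc n)
    show ?case
    proof (induction N)
      case 0
      then show ?case by (simp add: chi_0 del: right_bwd_summand.simps)
    next
      case (Suc N)
      have "image_fps (\<delta> N) (right_bwd_summand A m (Suc n)) =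
          ?L N * image_fps (?chi N) (right_bwd_summand A m n)"
        unfolding right_bwd_summand.simps
      proof (rule image_fps_cauchy)
        fix g :: "'l \<times> 'a" and h :: "'l list \<times> 'a"
        obtain a w a' x where gh: "g = (x, a)" "h = (w, a')" by (metis surj_pair)
        have "word_image p N w * \<alpha> s a = \<alpha> s a * word_image p N w"
          by (rule supported_mult_commute[OF supported_word_image[OF subset_refl] placement_supported[OF A]])
            (use S in auto)
        then have comm: "\<alpha> s a * (word_image p N w * y) = word_image p N w * (\<alpha> s a * y)" for y
          by (simp flip: mult.assoc)
        \<comment> \<open>The new factor stands on the left while its letter comes last in the word,
          so besides its component in \<open>A\<close> the letter itself must pass the copies below
          \<open>N\<close>.\<close>
        have comm': "letter (p, N) x * (word_image p N w * y) = word_image p N w * (letter (p, N) x * y)"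
          for y :: "'l places \<Rightarrow>\<^sub>0 'k"
          by (simp add: word_image_letter_commute flip: mult.assoc)
        show "lin_ext (\<delta> N) ((case g of (x, a) \<Rightarrow> \<lambda>(w, a'). ftensor (gen (w @ [x])) (gmult A a a')) h) =
            pair_place (\<lambda>_::unit. letter (p, N)) \<alpha> ((), s) g * ?chi N h"
          by (simp add: gh lin_ext_ftensor_gen_left \<delta>_def placement_gmult[OF A] mult.assoc comm comm'
              flip: lin_ext_times_left)
      qed
      with Suc.IH show ?case
        by (simp add: chi_Suc n.IH mult_dir_def del: right_bwd_summand.simps)
    qed
  qed
qed

lemma left_fwd_dec_prod_coset_series:
  fixes \<alpha> :: "'s \<Rightarrow> 'a \<Rightarrow> ('l places \<Rightarrow>\<^sub>0 'k)"
  assumes A: "placement A S \<alpha>" and S: "S \<inter> {q} \<times> UNIV = {}"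
  shows "left_fwd_dec_prod scale A (coset_series (A \<otimes> alg_L scale) l) =
    coset_series (A \<otimes> alg_T scale) (\<lambda>i. \<Sum>n<i. left_fwd_summand A l n i)"
  unfolding left_fwd_dec_prod_def
proof (rule lift1_coset_series)
  \<comment> \<open>Disjointness is stated for every copy \<open>j\<close>, since representatives
    are compared with L placed at each copy in turn. The copy 0 chosen below only fixes one
    placement of the source.\<close>
  have Sj: "S \<inter> {(q, j)} = {}" for j using S by auto
  show "placement (A \<otimes> alg_L scale) (S \<union> {(q, 0)}) (pair_place \<alpha> (\<lambda>_::unit. letter (q, 0)))"
    by (rule placement_tensor[OF A placement_L Sj])
  show "placement (A \<otimes> alg_T scale) (S \<union> {q} \<times> UNIV) (pair_place \<alpha> (word_image q))"
    by (rule placement_tensor[OF A placement_T S])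
  fix G and t :: "'s \<times> nat"
  assume G: "G \<in> reps (coset_series (A \<otimes> alg_L scale) l)"
  obtain s N where t: "t = (s, N)" by (cases t)
  show "image_fps (pair_place \<alpha> (word_image q) t) (\<lambda>i. \<Sum>n<i. left_fwd_summand A G n i) \<approx>
    image_fps (pair_place \<alpha> (word_image q) t) (\<lambda>i. \<Sum>n<i. left_fwd_summand A l n i)"
    unfolding t image_fps_truncated image_left_fwd_summand[OF A S]
    by (intro fps_cong_truncated fps_cong_dir_sum
        reps_coset_series_cong[OF placement_tensor[OF A placement_L Sj] G])
qed

lemma right_bwd_dec_prod_coset_series:
  fixes \<alpha> :: "'s \<Rightarrow> 'a \<Rightarrow> ('l places \<Rightarrow>\<^sub>0 'k)"
  assumes A: "placement A S \<alpha>" and S: "S \<inter> {p} \<times> UNIV = {}"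
  shows "right_bwd_dec_prod scale A (coset_series (alg_L scale \<otimes> A) m) =
    coset_series (alg_T scale \<otimes> A) (\<lambda>i. \<Sum>n<i. right_bwd_summand A m n i)"
  unfolding right_bwd_dec_prod_def
proof (rule lift1_coset_series)
  have Sj: "{(p, j)} \<inter> S = {}" for j using S by auto
  have S': "{p} \<times> UNIV \<inter> S = {}" using S by auto
  show "placement (alg_L scale \<otimes> A) ({(p, 0)} \<union> S) (pair_place (\<lambda>_::unit. letter (p, 0)) \<alpha>)"
    by (rule placement_tensor[OF placement_L A Sj])
  show "placement (alg_T scale \<otimes> A) ({p} \<times> UNIV \<union> S) (pair_place (word_image p) \<alpha>)"
    by (rule placement_tensor[OF placement_T A S'])
  fix G and t :: "nat \<times> 's"
  assume G: "G \<in> reps (coset_series (alg_L scale \<otimes> A) m)"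
  obtain N s where t: "t = (N, s)" by (cases t)
  show "image_fps (pair_place (word_image p) \<alpha> t) (\<lambda>i. \<Sum>n<i. right_bwd_summand A G n i) \<approx>
    image_fps (pair_place (word_image p) \<alpha> t) (\<lambda>i. \<Sum>n<i. right_bwd_summand A m n i)"
    unfolding t image_fps_truncated image_right_bwd_summand[OF A S]
    by (intro fps_cong_truncated fps_cong_dir_sum
        reps_coset_series_cong[OF placement_tensor[OF placement_L A Sj] G])
qed

definition edge :: "('l \<times> 'l, 'k) rseries \<Rightarrow> nat \<times> nat \<Rightarrow> nat \<times> nat \<Rightarrow> ('l places \<Rightarrow>\<^sub>0 'k) fps" where
  "edge F i j = image_fps (\<lambda>(x, y). letter i x * letter j y) F"

definition double_prod_series :: "('l \<times> 'l, 'k) rseries \<Rightarrow> ('l list \<times> 'l list, 'k) rseries" where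
  "double_prod_series F = (\<lambda>n. (if n = 0 then ftensor (gen []) (gen []) else 0) +
    (\<Sum>k<n. left_fwd_summand (alg_T scale) (\<lambda>i. \<Sum>n<i. right_bwd_summand (alg_L scale) F n i) k n))"

lemma image_truncated_left_fwd:
  assumes A: "placement A S \<alpha>" and S: "S \<inter> {q} \<times> UNIV = {}" and l: "l 0 = 0"
  shows "1 + image_fps (pair_place \<alpha> (word_image q) (s, N)) (\<lambda>i. \<Sum>n<i. left_fwd_summand A l n i) =
    dir_prod True (\<lambda>j. 1 + image_fps (pair_place \<alpha> (\<lambda>_::unit. letter (q, j)) (s, ())) l) N"
  unfolding image_fps_truncated image_left_fwd_summand[OF A S] dir_prod_eq_sum
  by (subst truncated_dir_sum_nth) (simp_all add: l fps_nth_inverse)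

lemma image_truncated_right_bwd:
  assumes A: "placement A S \<alpha>" and S: "S \<inter> {p} \<times> UNIV = {}" and m: "m 0 = 0"
  shows "1 + image_fps (pair_place (word_image p) \<alpha> (N, s)) (\<lambda>i. \<Sum>n<i. right_bwd_summand A m n i) =
    dir_prod False (\<lambda>i. 1 + image_fps (pair_place (\<lambda>_::unit. letter (p, i)) \<alpha> ((), s)) m) N"
  unfolding image_fps_truncated image_right_bwd_summand[OF A S] dir_prod_eq_sum
  by (subst truncated_dir_sum_nth) (simp_all add: m fps_nth_inverse)

text \<open>The outer integral is resolved first: its increment at copy \<open>j\<close> of factor
  \<open>q\<close> is the inner integral with L placed at \<open>(q, j)\<close>, and this is then
  resolved over the copies of factor \<open>p\<close>.\<close>

lemma image_double_prod_series:
  assumes F: "F 0 = 0" and pq: "p \<noteq> q"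
  shows "image_fps (pair_place (word_image p) (word_image q) (M, N)) (double_prod_series F) =
    dir_prod True (\<lambda>j. dir_prod False (\<lambda>i. 1 + edge F (p, i) (q, j)) M) N"
proof -
  let ?m = "\<lambda>i. \<Sum>n<i. right_bwd_summand (alg_L scale) F n i"
  have "image_fps (pair_place (word_image p) (word_image q) (M, N)) (double_prod_series F) =
    1 + image_fps (pair_place (word_image p) (word_image q) (M, N))
      (\<lambda>n. \<Sum>k<n. left_fwd_summand (alg_T scale) ?m k n)"
    unfolding double_prod_series_def image_fps_add
    by (rule arg_cong2[where f = plus]) (auto intro!: fps_ext)
  \<comment> \<open>The inner series vanishes at 0 as an empty sum, so it is an admissible
    increment.\<close>
  also have "\<dots> = dir_prod True (\<lambda>j. 1 +
      image_fps (pair_place (word_image p) (\<lambda>_::unit. letter (q, j)) (M, ())) ?m) N"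
    by (rule image_truncated_left_fwd[OF placement_T]) (use pq in auto)
  also have "\<dots> = dir_prod True (\<lambda>j. dir_prod False (\<lambda>i. 1 + edge F (p, i) (q, j)) M) N"
  proof -
    have "1 + image_fps (pair_place (word_image p) (\<lambda>_::unit. letter (q, j)) (M, ())) ?m =
        dir_prod False (\<lambda>i. 1 + edge F (p, i) (q, j)) M" for j
      unfolding edge_def
      by (subst image_truncated_right_bwd[OF placement_L]) (use pq F in \<open>auto simp: pair_place_eq\<close>)
    then show ?thesis by (simp only:)
  qed
  finally show ?thesis .
qed

lemma directed_double_prod_coset_series:
  "directed_double_prod scale (coset_series (alg_L scale \<otimes> alg_L scale) F) =
    coset_series (alg_T scale \<otimes> alg_T scale) (double_prod_series F)"
proof -
  \<comment> \<open>The factors 0 and 1 are one choice of disjoint places at which well-definedness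
    of the two nested integrals is checked.\<close>
  have L: "{(1::nat, 0::nat)} \<inter> {0} \<times> UNIV = {}" and T: "{0::nat} \<times> (UNIV :: nat set) \<inter> {1} \<times> UNIV = {}"
    by auto
  have const: "ser_const A f = coset_series A (\<lambda>n. if n = 0 then f else 0)"
    for A :: "('z, 'k) presented_algebra" and f
    by (rule ext) (simp add: ser_const_def coset_series_def)
  show ?thesis
    unfolding directed_double_prod_def left_fwd_prod_def
      right_bwd_dec_prod_coset_series[OF placement_L L]
      left_fwd_dec_prod_coset_series[OF placement_T T] const
      ser_add_coset_series[OF placement_tensor[OF placement_T placement_T T]] double_prod_series_def ..
qed

end


section \<open>Fusion of the Yang-Baxter equation\<close>

lemma fps_supported_dir_prod:
  "(\<And>j. j < N \<Longrightarrow> fps_supported S (L j)) \<Longrightarrow> fps_supported S (dir_prod fwd L N)"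
  by (induction N) (auto simp: mult_dir_def intro: fps_supported_mult)

text \<open>Fuses the first \<open>M\<close> copies of factor \<open>p\<close> into one leg facing
  the single place \<open>j\<close>; larger \<open>i\<close> stand further left.
  \<open>block\<close> then fuses the second leg, with larger indices further right, which matches
  \<open>image_double_prod_series\<close>.\<close>

definition column :: "(nat \<times> nat \<Rightarrow> nat \<times> nat \<Rightarrow> 'a::ring_1) \<Rightarrow> nat \<Rightarrow> nat \<Rightarrow> nat \<times> nat \<Rightarrow> 'a" where
  "column R p M j = dir_prod False (\<lambda>i. R (p, i) j) M"

definition block :: "(nat \<times> nat \<Rightarrow> nat \<times> nat \<Rightarrow> 'a::ring_1) \<Rightarrow> nat \<Rightarrow> nat \<Rightarrow> nat \<Rightarrow> nat \<Rightarrow> 'a" where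
  "block R p q M N = dir_prod True (\<lambda>j. column R p M (q, j)) N"

lemma column_simps:
  "column R p 0 j = 1" "column R p (Suc M) j = R (p, M) j * column R p M j"
  by (simp_all add: column_def mult_dir_def)

lemma block_simps:
  "block R p q M 0 = 1" "block R p q M (Suc N) = block R p q M N * column R p M (q, N)"
  by (simp_all add: block_def mult_dir_def)

lemma block_1: "block R p q (Suc 0) (Suc 0) = R (p, 0) (q, 0)"
  by (simp add: block_simps column_simps)

context fin_dim_algebra
begin

section \<open>Fusion for an abstract family R of elements at pairs of places\<close>

context
  fixes R :: "nat \<times> nat \<Rightarrow> nat \<times> nat \<Rightarrow> ('l places \<Rightarrow>\<^sub>0 'k) fps"
  assumes supp: "\<And>i j. fps_supported {i, j} (R i j)"
    and YB: "\<And>i j k. distinct [i, j, k] \<Longrightarrow> R i j * R i k * R j k \<approx> R j k * R i k * R i j"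
begin

lemma supported_column: "fps_supported ({p} \<times> {..<M} \<union> {j}) (column R p M j)"
  unfolding column_def by (rule fps_supported_dir_prod) (auto intro: fps_supported_mono[OF supp])

lemma supported_block: "fps_supported ({p} \<times> {..<M} \<union> {q} \<times> {..<N}) (block R p q M N)"
  unfolding block_def by (rule fps_supported_dir_prod) (auto intro: fps_supported_mono[OF supported_column])

lemma fps_cong_mult_middle: "Y \<approx> Y' \<Longrightarrow> X * Y * Z \<approx> X * Y' * Z"
  by (intro fps_cong_mult fps_cong_refl)

text \<open>Fuses the first leg of the equation. The factors at the new copy \<open>(p, M)\<close>
  commute with column factors sharing none of their places, so one Yang-Baxter move at
  \<open>(p, M)\<close>, \<open>j\<close>, \<open>k\<close> and the induction hypothesis
  suffice.\<close>

lemma column_fusion: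
  assumes "fst j \<noteq> p" "fst k \<noteq> p" "j \<noteq> k"
  shows "column R p M j * column R p M k * R j k \<approx> R j k * column R p M k * column R p M j"
proof (induction M)
  case (Suc M)
  let ?C = "column R p M" and ?R = "R (p, M)"
  have 1: "?C j * ?R k = ?R k * ?C j"
    by (rule fps_supported_mult_commute[OF supported_column supp]) (use assms in auto)
  have 2: "?C k * ?R j = ?R j * ?C k"
    by (rule fps_supported_mult_commute[OF supported_column supp]) (use assms in auto)
  have "column R p (Suc M) j * column R p (Suc M) k * R j k = ?R j * (?C j * ?R k) * ?C k * R j k"
    by (simp add: column_simps mult.assoc)
  \<comment> \<open>The factor 1 only supplies the outer factor that
    \<open>fps_cong_mult_middle\<close> expects.\<close>
  also have "\<dots> = ?R j * ?R k * (?C j * ?C k * R j k) * 1"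
    by (simp add: 1 mult.assoc)
  also have "\<dots> \<approx> ?R j * ?R k * (R j k * ?C k * ?C j) * 1"
    by (rule fps_cong_mult_middle[OF Suc.IH])
  also have "\<dots> = 1 * (?R j * ?R k * R j k) * (?C k * ?C j)"
    by (simp add: mult.assoc)
  also have "\<dots> \<approx> 1 * (R j k * ?R k * ?R j) * (?C k * ?C j)"
    by (rule fps_cong_mult_middle[OF YB]) (use assms in auto)
  also have "\<dots> = R j k * ?R k * (?C k * ?R j) * ?C j"
    by (simp add: 2 mult.assoc)
  also have "\<dots> = R j k * column R p (Suc M) k * column R p (Suc M) j"
    by (simp add: column_simps mult.assoc)
  finally show ?case .
qed (simp add: column_simps)

text \<open>Fuses the second leg: each further copy \<open>(q, N)\<close> is moved by
  \<open>column_fusion\<close>, in which the first leg is already fused.\<close>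

lemma block_column_fusion:
  assumes "p \<noteq> q" "fst k \<noteq> p" "fst k \<noteq> q"
  shows "block R p q M N * column R p M k * column R q N k \<approx> column R q N k * column R p M k * block R p q M N"
proof (induction N)
  case 0
  then show ?case by (simp add: column_simps block_simps)
next
  case (Suc N)
  let ?B = "block R p q M N" and ?c = "column R p M (q, N)" and ?r = "R (q, N) k"
    and ?P = "column R p M k" and ?Q = "column R q N k"
  have 1: "?B * ?r = ?r * ?B"
    by (rule fps_supported_mult_commute[OF supported_block supp]) (use assms in auto)
  have 2: "?c * ?Q = ?Q * ?c"
    by (rule fps_supported_mult_commute[OF supported_column supported_column]) (use assms in auto)
  have "block R p q M (Suc N) * ?P * column R q (Suc N) k = ?B * (?c * ?P * ?r) * ?Q"
    by (simp add: column_simps block_simps mult.assoc)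
  also have "\<dots> \<approx> ?B * (?r * ?P * ?c) * ?Q"
    by (rule fps_cong_mult_middle[OF column_fusion]) (use assms in auto)
  also have "\<dots> = (?B * ?r) * ?P * (?c * ?Q)" by (simp add: mult.assoc)
  also have "\<dots> = ?r * (?B * ?P * ?Q) * ?c" unfolding 1 2 by (simp add: mult.assoc)
  also have "\<dots> \<approx> ?r * (?Q * ?P * ?B) * ?c" by (rule fps_cong_mult_middle[OF Suc.IH])
  also have "\<dots> = column R q (Suc N) k * ?P * block R p q M (Suc N)"
    by (simp add: column_simps block_simps mult.assoc)
  finally show ?case .
qed

text \<open>Fuses the third leg, each copy \<open>(t, K)\<close> being moved by
  \<open>block_column_fusion\<close>.\<close>

lemma block_fusion:
  assumes "distinct [p, q, t]"
  shows "block R p q M N * block R p t M K * block R q t N K \<approx>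
    block R q t N K * block R p t M K * block R p q M N"
proof (induction K)
  case 0
  then show ?case by (simp add: block_simps)
next
  case (Suc K)
  let ?B = "block R p q M N" and ?P = "block R p t M K" and ?Q = "block R q t N K"
    and ?c = "column R p M (t, K)" and ?d = "column R q N (t, K)"
  have 1: "?c * ?Q = ?Q * ?c"
    by (rule fps_supported_mult_commute[OF supported_column supported_block]) (use assms in auto)
  have 2: "?P * ?d = ?d * ?P"
    by (rule fps_supported_mult_commute[OF supported_block supported_column]) (use assms in auto)
  have "?B * block R p t M (Suc K) * block R q t N (Suc K) = ?B * ?P * (?c * ?Q) * ?d"
    by (simp add: block_simps mult.assoc)
  also have "\<dots> = 1 * (?B * ?P * ?Q) * (?c * ?d)" unfolding 1 by (simp add: mult.assoc)
  also have "\<dots> \<approx> 1 * (?Q * ?P * ?B) * (?c * ?d)" by (rule fps_cong_mult_middle[OF Suc.IH])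
  also have "\<dots> = ?Q * ?P * (?B * ?c * ?d) * 1" by (simp add: mult.assoc)
  also have "\<dots> \<approx> ?Q * ?P * (?d * ?c * ?B) * 1"
    by (rule fps_cong_mult_middle[OF block_column_fusion]) (use assms in auto)
  also have "\<dots> = ?Q * (?P * ?d) * ?c * ?B" by (simp add: mult.assoc)
  also have "\<dots> = block R q t N (Suc K) * block R p t M (Suc K) * ?B"
    unfolding 2 by (simp add: block_simps mult.assoc)
  finally show ?case .
qed

end

section \<open>The two equations of the theorem in terms of places\<close>

lemma fps_supported_edge: "fps_supported {i, j} (1 + edge F i j)"
  unfolding edge_def
  by (intro fps_supported_add fps_supported_1 fps_supported_image)
    (auto intro!: supported_mult supported_letter)

lemma fps_cong_iff_diff: "X - Y = X' - Y' \<Longrightarrow> X \<approx> Y \<longleftrightarrow> X' \<approx> Y'"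
  by (simp only: fps_cong_def)

abbreviation edge_YB :: "('l \<times> 'l, 'k) rseries \<Rightarrow> nat \<times> nat \<Rightarrow> nat \<times> nat \<Rightarrow> nat \<times> nat \<Rightarrow> bool" where
  "edge_YB F i j k \<equiv> (1 + edge F i j) * (1 + edge F i k) * (1 + edge F j k) \<approx>
     (1 + edge F j k) * (1 + edge F i k) * (1 + edge F i j)"

text \<open>The left side mentions no places, whereas \<open>i\<close>, \<open>j\<close>,
  \<open>k\<close> are any three distinct ones. Applied to two triples, the lemma transfers the
  Yang-Baxter equation from one to the other.\<close>

lemma L3_equation_iff:
  assumes ijk: "distinct [i, j, k]"
  shows "(let L3 = alg_L1 scale \<otimes> alg_L1 scale \<otimes> alg_L1 scale;
          r = coset_series (alg_L scale \<otimes> alg_L scale) F;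
          r12 = ser_place L3 (\<lambda>(x, y). (Some x, Some y, None)) r;
          r13 = ser_place L3 (\<lambda>(x, y). (Some x, None, Some y)) r;
          r23 = ser_place L3 (\<lambda>(x, y). (None, Some x, Some y)) r
      in r12 \<bullet>\<^bsub>L3\<^esub> r13 \<oplus>\<^bsub>L3\<^esub> r12 \<bullet>\<^bsub>L3\<^esub> r23 \<oplus>\<^bsub>L3\<^esub> r13 \<bullet>\<^bsub>L3\<^esub> r23
           \<oplus>\<^bsub>L3\<^esub> r12 \<bullet>\<^bsub>L3\<^esub> r13 \<bullet>\<^bsub>L3\<^esub> r23
       = r13 \<bullet>\<^bsub>L3\<^esub> r12 \<oplus>\<^bsub>L3\<^esub> r23 \<bullet>\<^bsub>L3\<^esub> r12 \<oplus>\<^bsub>L3\<^esub> r23 \<bullet>\<^bsub>L3\<^esub> r13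
           \<oplus>\<^bsub>L3\<^esub> r23 \<bullet>\<^bsub>L3\<^esub> r13 \<bullet>\<^bsub>L3\<^esub> r12) \<longleftrightarrow> edge_YB F i j k"
proof -
  let ?L2 = "alg_L scale \<otimes> alg_L scale" and ?L3 = "alg_L1 scale \<otimes> alg_L1 scale \<otimes> alg_L1 scale"
  let ?\<alpha> = "\<lambda>i j. pair_place (\<lambda>_::unit. letter i) (\<lambda>_::unit. letter j) :: _ \<Rightarrow> _ \<Rightarrow> ('l places \<Rightarrow>\<^sub>0 'k)"
  let ?\<beta> = "pair_place (\<lambda>_::unit. opt_letter i)
    (pair_place (\<lambda>_::unit. opt_letter j) (\<lambda>_::unit. opt_letter k))"
  have L2: "placement ?L2 ({a} \<union> {b}) (?\<alpha> a b)" if "a \<noteq> b" for a b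
    using that by (intro placement_tensor placement_L) auto
  have L3: "placement ?L3 ({i} \<union> ({j} \<union> {k})) ?\<beta>"
    using ijk by (intro placement_tensor placement_L1) auto
  have beta: "(\<lambda>g. ?\<beta> ((), (), ()) (case g of (x, y) \<Rightarrow> (Some x, Some y, None))) = ?\<alpha> i j ((), ())"
    "(\<lambda>g. ?\<beta> ((), (), ()) (case g of (x, y) \<Rightarrow> (Some x, None, Some y))) = ?\<alpha> i k ((), ())"
    "(\<lambda>g. ?\<beta> ((), (), ()) (case g of (x, y) \<Rightarrow> (None, Some x, Some y))) = ?\<alpha> j k ((), ())"
    by auto
  have edge: "edge F a b = image_fps (?\<alpha> a b ((), ())) F" for a b
    by (simp add: edge_def pair_place_eq)
  have place12: "ser_place ?L3 (\<lambda>(x, y). (Some x, Some y, None)) (coset_series ?L2 F) =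
      coset_series ?L3 (\<lambda>n. lin_ext (\<lambda>g. gen (case g of (x, y) \<Rightarrow> (Some x, Some y, None))) (F n))"
    by (rule ser_place_coset_series[OF L2[of i j] L3, where sel = "\<lambda>_. ((), ())"]) (use ijk in auto)
  have place13: "ser_place ?L3 (\<lambda>(x, y). (Some x, None, Some y)) (coset_series ?L2 F) =
      coset_series ?L3 (\<lambda>n. lin_ext (\<lambda>g. gen (case g of (x, y) \<Rightarrow> (Some x, None, Some y))) (F n))"
    by (rule ser_place_coset_series[OF L2[of i k] L3, where sel = "\<lambda>_. ((), ())"]) (use ijk in auto)
  have place23: "ser_place ?L3 (\<lambda>(x, y). (None, Some x, Some y)) (coset_series ?L2 F) =
      coset_series ?L3 (\<lambda>n. lin_ext (\<lambda>g. gen (case g of (x, y) \<Rightarrow> (None, Some x, Some y))) (F n))"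
    by (rule ser_place_coset_series[OF L2[of j k] L3, where sel = "\<lambda>_. ((), ())"]) (use ijk in auto)
  \<comment> \<open>The placement of the triple tensor product has a single index, so a single
    congruence remains.\<close>
  have all_unit: "(\<forall>s :: unit \<times> unit \<times> unit. P s) \<longleftrightarrow> P ((), (), ())" for P
    by (metis (full_types) old.unit.exhaust surj_pair)
  show ?thesis
    unfolding Let_def place12 place13 place23 ser_mult_coset_series[OF L3] ser_add_coset_series[OF L3]
      coset_series_eq_iff[OF L3] all_unit image_fps_add image_fps_gmult[OF L3] image_fps_rename beta
      edge[symmetric]
    by (rule fps_cong_iff_diff) (simp add: algebra_simps)
qed

lemma T3_equation_iff:
  assumes F: "F 0 = 0"
  shows "(let T3 = alg_T scale \<otimes> alg_T scale \<otimes> alg_T scale;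
          R = directed_double_prod scale (coset_series (alg_L scale \<otimes> alg_L scale) F);
          R12 = ser_place T3 (\<lambda>(u, v). (u, v, [])) R;
          R13 = ser_place T3 (\<lambda>(u, v). (u, [], v)) R;
          R23 = ser_place T3 (\<lambda>(u, v). ([], u, v)) R
      in R12 \<bullet>\<^bsub>T3\<^esub> R13 \<bullet>\<^bsub>T3\<^esub> R23 = R23 \<bullet>\<^bsub>T3\<^esub> R13 \<bullet>\<^bsub>T3\<^esub> R12) \<longleftrightarrow>
    (\<forall>M N K. let B = block (\<lambda>i j. 1 + edge F i j)
      in B 0 1 M N * B 0 2 M K * B 1 2 N K \<approx> B 1 2 N K * B 0 2 M K * B 0 1 M N)"
proof -
  let ?T2 = "alg_T scale \<otimes> alg_T scale" and ?T3 = "alg_T scale \<otimes> alg_T scale \<otimes> alg_T scale"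
  let ?S = "\<lambda>p::nat. {p} \<times> (UNIV :: nat set)"
  let ?\<alpha> = "\<lambda>p q. pair_place (word_image p) (word_image q) :: _ \<Rightarrow> _ \<Rightarrow> ('l places \<Rightarrow>\<^sub>0 'k)"
  let ?\<beta> = "pair_place (word_image 0) (pair_place (word_image 1) (word_image 2))
    :: _ \<Rightarrow> _ \<Rightarrow> ('l places \<Rightarrow>\<^sub>0 'k)"
  let ?B = "block (\<lambda>i j. 1 + edge F i j)"
  have T2: "placement ?T2 (?S p \<union> ?S q) (?\<alpha> p q)" if "p \<noteq> q" for p q
    using that by (intro placement_tensor placement_T) auto
  have T3: "placement ?T3 (?S 0 \<union> (?S 1 \<union> ?S 2)) ?\<beta>"
    by (intro placement_tensor placement_T) auto
  \<comment> \<open>The inserted empty word has image 1, so only the copy numbers of the two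
    occupied tensor factors survive.\<close>
  have beta: "(\<lambda>g. ?\<beta> (M, N, K) (case g of (u, v) \<Rightarrow> (u, v, []))) = ?\<alpha> 0 1 (M, N)"
    "(\<lambda>g. ?\<beta> (M, N, K) (case g of (u, v) \<Rightarrow> (u, [], v))) = ?\<alpha> 0 2 (M, K)"
    "(\<lambda>g. ?\<beta> (M, N, K) (case g of (u, v) \<Rightarrow> ([], u, v))) = ?\<alpha> 1 2 (N, K)" for M N K
    by auto
  have block: "image_fps (?\<alpha> p q (M, N)) (double_prod_series F) = ?B p q M N" if "p \<noteq> q" for p q M N
    unfolding image_double_prod_series[of F, OF F that] block_def column_def ..
  have place12: "ser_place ?T3 (\<lambda>(u, v). (u, v, [])) (coset_series ?T2 G) =
      coset_series ?T3 (\<lambda>n. lin_ext (\<lambda>g. gen (case g of (u, v) \<Rightarrow> (u, v, []))) (G n))" for G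
    by (rule ser_place_coset_series[OF T2[of 0 1] T3, where sel = "\<lambda>(M, N, K). (M, N)"]) auto
  have place13: "ser_place ?T3 (\<lambda>(u, v). (u, [], v)) (coset_series ?T2 G) =
      coset_series ?T3 (\<lambda>n. lin_ext (\<lambda>g. gen (case g of (u, v) \<Rightarrow> (u, [], v))) (G n))" for G
    by (rule ser_place_coset_series[OF T2[of 0 2] T3, where sel = "\<lambda>(M, N, K). (M, K)"]) auto
  have place23: "ser_place ?T3 (\<lambda>(u, v). ([], u, v)) (coset_series ?T2 G) =
      coset_series ?T3 (\<lambda>n. lin_ext (\<lambda>g. gen (case g of (u, v) \<Rightarrow> ([], u, v))) (G n))" for G
    by (rule ser_place_coset_series[OF T2[of 1 2] T3, where sel = "\<lambda>(M, N, K). (N, K)"]) auto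
  show ?thesis
    unfolding Let_def directed_double_prod_coset_series place12 place13 place23
      ser_mult_coset_series[OF T3] coset_series_eq_iff[OF T3] split_paired_All
      image_fps_gmult[OF T3] image_fps_rename beta
    by (simp add: block)
qed

lemma block_equations_iff_edge_YB:
  assumes F: "F 0 = 0"
  shows "(\<forall>M N K. let B = block (\<lambda>i j. 1 + edge F i j)
      in B 0 1 M N * B 0 2 M K * B 1 2 N K \<approx> B 1 2 N K * B 0 2 M K * B 0 1 M N) \<longleftrightarrow>
    edge_YB F (0, 0) (1, 0) (2, 0)" (is "?block \<longleftrightarrow> ?edge")
proof
  assume ?block
  then show ?edge
    unfolding Let_def by (auto simp: block_1 dest!: spec[of _ "Suc 0"])
next
  assume ?edge
  \<comment> \<open>The equation is carried from the triple \<open>(0, 0)\<close>,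
    \<open>(1, 0)\<close>, \<open>(2, 0)\<close> to an arbitrary one, as fusion meets all copies of
    the three tensor factors.\<close>
  have "edge_YB F i j k" if "distinct [i, j, k]" for i j k
    using \<open>?edge\<close> L3_equation_iff[OF that, of F]
      L3_equation_iff[of "(0, 0)" "(1, 0)" "(2, 0)" F]
    by simp
  then show ?block
    unfolding Let_def by (intro allI block_fusion fps_supported_edge) auto
qed

end

theorem theorem1:
  fixes scale :: "'k::field \<Rightarrow> 'l::ring \<Rightarrow> 'l"
    and Basis :: "'l set"
    and r :: "('l \<times> 'l, 'k) series"
  assumes "fin_dim_algebra scale Basis"
    and "r \<in> hseries (alg_L scale \<otimes> alg_L scale)"
  shows
    "(let T3 = alg_T scale \<otimes> alg_T scale \<otimes> alg_T scale;
          R = directed_double_prod scale r;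
          R12 = ser_place T3 (\<lambda>(u, v). (u, v, [])) R;
          R13 = ser_place T3 (\<lambda>(u, v). (u, [], v)) R;
          R23 = ser_place T3 (\<lambda>(u, v). ([], u, v)) R
      in R12 \<bullet>\<^bsub>T3\<^esub> R13 \<bullet>\<^bsub>T3\<^esub> R23 = R23 \<bullet>\<^bsub>T3\<^esub> R13 \<bullet>\<^bsub>T3\<^esub> R12)
     \<longleftrightarrow>
     (let L3 = alg_L1 scale \<otimes> alg_L1 scale \<otimes> alg_L1 scale;
          r12 = ser_place L3 (\<lambda>(x, y). (Some x, Some y, None)) r;
          r13 = ser_place L3 (\<lambda>(x, y). (Some x, None, Some y)) r;
          r23 = ser_place L3 (\<lambda>(x, y). (None, Some x, Some y)) r
      in r12 \<bullet>\<^bsub>L3\<^esub> r13 \<oplus>\<^bsub>L3\<^esub> r12 \<bullet>\<^bsub>L3\<^esub> r23 \<oplus>\<^bsub>L3\<^esub> r13 \<bullet>\<^bsub>L3\<^esub> r23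
           \<oplus>\<^bsub>L3\<^esub> r12 \<bullet>\<^bsub>L3\<^esub> r13 \<bullet>\<^bsub>L3\<^esub> r23
       = r13 \<bullet>\<^bsub>L3\<^esub> r12 \<oplus>\<^bsub>L3\<^esub> r23 \<bullet>\<^bsub>L3\<^esub> r12 \<oplus>\<^bsub>L3\<^esub> r23 \<bullet>\<^bsub>L3\<^esub> r13
           \<oplus>\<^bsub>L3\<^esub> r23 \<bullet>\<^bsub>L3\<^esub> r13 \<bullet>\<^bsub>L3\<^esub> r12)"
proof -
  interpret fin_dim_algebra scale Basis by (rule assms(1))
  obtain F where r: "r = coset_series (alg_L scale \<otimes> alg_L scale) F" and F: "F 0 = 0"
    using hseries_eq_coset_series[OF assms(2)] by blast
  have "distinct [(0, 0), (1, 0), (2::nat, 0::nat)]" by simp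
  from T3_equation_iff[of F, OF F] block_equations_iff_edge_YB[of F, OF F] L3_equation_iff[OF this, of F]
  show ?thesis unfolding r Let_def by (simp only:)
qed

end
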